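(* For $z\in\mathbb{R}$ let $\mathcal{D}(z):=\{X\in\mathcal{S}_+^n:\ \operatorname{rank}(X)\le k,\ \log\det(X+\alpha I_n)\ge z\}$. Consider the problem (Kernel Learning) $$\min_{z\in\mathbb{R},\,X\in\mathcal{D}(z)}\{\langle Y^\dagger,X\rangle-z+\log\det(Y+\alpha I_n):\ b_i^l\le\langle A_i,X\rangle\le b_i^u,\ \forall i\in[m]\}$$ and its relaxation (Kernel Learning-R) $$V_{\rm rel}:=\min_{z\in\mathbb{R},\,X\in\operatorname{conv}(\mathcal{D}(z))}\{\langle Y^\dagger,X\rangle-z+\log\det(Y+\alpha I_n):\ b_i^l\le\langle A_i,X\rangle\le b_i^u,\ \forall i\in[m]\}.$$ Let $\tilde m$ be the number of linearly independent matrices among $A_1,\dots,A_m$. Then there exists an optimal solution of Kernel Learning-R with rank (of its matrix component $X$) at most $k+\lfloor\sqrt{2\tilde m+9/4}-3/2\rfloor$. Besides, if $\tilde m\le1$, then Kernel Learning-R achieves the same optimal value as Kernel Learning.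
   Context: $k\le n$ are positive integers; $[m]=\{1,\dots,m\}$; $\mathcal{S}_+^n$ is the set of $n\times n$ real symmetric positive semidefinite matrices; $\langle\cdot,\cdot\rangle$ is the Frobenius inner product; $\operatorname{conv}$ denotes convex hull; $I_n$ is the identity matrix. $Y\in\mathcal{S}_+^n$ is a given matrix of rank at most $k$, $Y^\dagger$ its Moore–Penrose inverse, and $\alpha>0$. $A_1,\dots,A_m$ are real symmetric $n\times n$ matrices and $-\infty\le b_i^l\le b_i^u\le+\infty$. The number $\tilde m$ is the dimension of the linear span of $\{A_i\}_{i\in[m]}$.
   Formalization: The existence of an optimal solution of Kernel Learning-R with the rank bound is stated under the assumption that V_rel is finite (the relaxation is feasible and bounded below); otherwise no optimal solution exists, e.g. for A_1 = I_n and b_1^u = -1. *)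

theory Defs
  imports "HOL-Analysis.Analysis"
begin

definition psd :: "real^'n^'n \<Rightarrow> bool" where
  "psd X \<longleftrightarrow> transpose X = X \<and> (\<forall>v. 0 \<le> v \<bullet> (X *v v))"

text \<open>The four Penrose equations, which determine the Moore--Penrose inverse uniquely.\<close>

definition is_pinv :: "real^'n^'m \<Rightarrow> real^'m^'n \<Rightarrow> bool" where
  "is_pinv A P \<longleftrightarrow>
     A ** P ** A = A \<and> P ** A ** P = P \<and>
     transpose (A ** P) = A ** P \<and> transpose (P ** A) = P ** A"

definition pinv :: "real^'n^'m \<Rightarrow> real^'m^'n" where
  "pinv A = (THE P. is_pinv A P)"

lemma is_pinv_unique:
  assumes "is_pinv A P" "is_pinv A Q"
  shows "P = Q"
proof -
  have P: "A ** P ** A = A" "P ** A ** P = P" "transpose (A ** P) = A ** P" "transpose (P ** A) = P ** A"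
    and Q: "A ** Q ** A = A" "Q ** A ** Q = Q" "transpose (A ** Q) = A ** Q" "transpose (Q ** A) = Q ** A"
    using assms unfolding is_pinv_def by auto
  have "A ** P = transpose (A ** Q ** (A ** P))"
    using P(3) Q(1) by (metis matrix_mul_assoc)
  then have 1: "A ** P = A ** Q"
    using P(1,3) Q(3) by (metis matrix_mul_assoc matrix_transpose_mul)
  have "P ** A = transpose (P ** A ** (Q ** A))"
    using P(4) Q(1) by (metis matrix_mul_assoc)
  then have 2: "P ** A = Q ** A"
    using P(1,4) Q(4) by (metis matrix_mul_assoc matrix_transpose_mul)
  show ?thesis
    using 1 2 P(2) Q(2) by (metis matrix_mul_assoc)
qed

lemma is_pinv_exists:
  fixes A :: "real^'n^'m"
  shows "\<exists>P. is_pinv A P"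
proof -
  define N where "N = {x. A *v x = 0}"
  define R where "R = range (\<lambda>x. A *v x)"
  have N: "subspace N"
    unfolding N_def by (simp add: subspace_def matrix_vector_right_distrib matrix_vector_mult_scaleR)
  have R: "subspace R"
    unfolding R_def by (intro linear_subspace_image) auto
  have dec: "\<exists>x y. x \<in> S \<and> (\<forall>w\<in>S. orthogonal y w) \<and> v = x + y" if "subspace S" for v and S :: "(real^'k) set"
    using orthogonal_subspace_decomp_exists[of S v] that by (metis span_eq_iff)
  have "\<exists>x. (\<forall>w\<in>N. orthogonal x w) \<and> (\<forall>r\<in>R. orthogonal (y - A *v x) r)" for y
  proof -
    obtain a b where ab: "a \<in> R" "\<forall>w\<in>R. orthogonal b w" "y = a + b" using dec[OF R] by blast
    obtain u where u: "a = A *v u" using ab R_def by auto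
    obtain c x where cx: "c \<in> N" "\<forall>w\<in>N. orthogonal x w" "u = c + x" using dec[OF N] by blast
    have "A *v x = a" using cx u by (simp add: N_def matrix_vector_right_distrib)
    with cx ab show ?thesis by auto
  qed
  then obtain p where p: "\<And>y w. w \<in> N \<Longrightarrow> p y \<bullet> w = 0" "\<And>y r. r \<in> R \<Longrightarrow> (y - A *v p y) \<bullet> r = 0"
    unfolding orthogonal_def by metis
  have uniq: "x = x'" if "\<And>w. w \<in> N \<Longrightarrow> x \<bullet> w = 0" "\<And>w. w \<in> N \<Longrightarrow> x' \<bullet> w = 0"
    "\<And>r. r \<in> R \<Longrightarrow> (y - A *v x) \<bullet> r = 0" "\<And>r. r \<in> R \<Longrightarrow> (y - A *v x') \<bullet> r = 0" for x x' y
  proof -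
    have r: "A *v (x - x') \<in> R" by (simp add: R_def)
    have "A *v (x - x') = (y - A *v x') - (y - A *v x)" by (simp add: matrix_vector_mult_diff_distrib)
    then have "(A *v (x - x')) \<bullet> (A *v (x - x')) = 0"
      using that(3,4)[OF r] by (metis inner_diff_left diff_zero)
    then have n: "x - x' \<in> N" by (simp add: N_def)
    have "(x - x') \<bullet> (x - x') = 0"
      using that(1,2)[OF n] by (metis inner_diff_left diff_zero)
    then show ?thesis by simp
  qed
  have "linear p"
  proof (rule linearI)
    show "p (y + z) = p y + p z" for y z
      by (rule uniq[of _ _ "y + z"])
        (use p(1) p(2)[of _ y] p(2)[of _ z] p(2)[of _ "y + z"] in
          \<open>auto simp: inner_add_left inner_diff_left matrix_vector_right_distrib\<close>)
    show "p (c *\<^sub>R y) = c *\<^sub>R p y" for c y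
      by (rule uniq[of _ _ "c *\<^sub>R y"])
        (use p(1) p(2)[of _ y] p(2)[of _ "c *\<^sub>R y"] in
          \<open>auto simp: inner_diff_left matrix_vector_mult_scaleR\<close>)
  qed
  then have P: "matrix p *v y = p y" for y
    by (simp add: matrix_works)
  have sym: "transpose B = B" if "\<And>x y. (B *v x) \<bullet> y = x \<bullet> (B *v y)" for B :: "real^'k^'k"
  proof -
    have "(transpose B *v x - B *v x) \<bullet> y = 0" for x y
      using that[of x y] by (simp add: inner_diff_left dot_lmul_matrix flip: transpose_matrix_vector) (metis dot_lmul_matrix transpose_matrix_vector)
    then have "transpose B *v x = B *v x" for x
      by (metis eq_iff_diff_eq_0 inner_eq_zero_iff)
    then show ?thesis by (simp add: matrix_eq)
  qed
  have pA: "A *v p (A *v x) = A *v x" for x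
  proof -
    have "A *v x - A *v p (A *v x) \<in> R"
      by (metis R R_def rangeI subspace_diff)
    then have "(A *v x - A *v p (A *v x)) \<bullet> (A *v x - A *v p (A *v x)) = 0" by (rule p)
    then show ?thesis by simp
  qed
  have AP: "(A *v p x) \<bullet> y = (A *v p x) \<bullet> (A *v p y)" for x y
    using p(2)[of "A *v p x" y] unfolding R_def by (simp add: inner_diff_left) (metis inner_commute)
  have PA: "p (A *v x) \<bullet> y = p (A *v x) \<bullet> p (A *v y)" for x y
    using p(1)[of "y - p (A *v y)" "A *v x"] pA
    by (simp add: N_def matrix_vector_mult_diff_distrib inner_diff_right)
  have pAp: "p (A *v p y) = p y" for y
    by (rule uniq[of _ _ y]) (use p pA in auto)
  have "is_pinv A (matrix p)"
    unfolding is_pinv_def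
  proof (intro conjI)
    show "A ** matrix p ** A = A" "matrix p ** A ** matrix p = matrix p"
      by (simp_all add: matrix_eq P pA pAp flip: matrix_vector_mul_assoc)
    show "transpose (A ** matrix p) = A ** matrix p" "transpose (matrix p ** A) = matrix p ** A"
      by (rule sym; simp add: P flip: matrix_vector_mul_assoc; metis AP PA inner_commute)+
  qed
  then show ?thesis ..
qed

lemma is_pinv_pinv: "is_pinv A (pinv A)"
  unfolding pinv_def using is_pinv_exists is_pinv_unique by (metis theI)

text \<open>
  Only applied to positive definite matrices, whose determinant is positive, so the value of
  \<^const>\<open>ln\<close> outside the positive reals is irrelevant.
\<close>

definition logdet :: "real^'n^'n \<Rightarrow> real" where
  "logdet X = ln (det X)"

definition kl_domain :: "nat \<Rightarrow> real \<Rightarrow> real \<Rightarrow> (real^'n^'n) set" where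
  "kl_domain k \<alpha> z = {X. psd X \<and> rank X \<le> k \<and> logdet (X + \<alpha> *\<^sub>R mat 1) \<ge> z}"

text \<open>The inner product of the type \<^typ>\<open>real^'n^'n\<close> is the Frobenius inner product.\<close>

definition kl_objective :: "real \<Rightarrow> real^'n^'n \<Rightarrow> real \<times> (real^'n^'n) \<Rightarrow> real" where
  "kl_objective \<alpha> Y = (\<lambda>(z, X). pinv Y \<bullet> X - z + logdet (Y + \<alpha> *\<^sub>R mat 1))"

definition linear_constraints ::
  "nat \<Rightarrow> (nat \<Rightarrow> real^'n^'n) \<Rightarrow> (nat \<Rightarrow> ereal) \<Rightarrow> (nat \<Rightarrow> ereal) \<Rightarrow> (real^'n^'n) set" where
  "linear_constraints m A bl bu =
     {X. \<forall>i\<in>{1..m}. bl i \<le> ereal (A i \<bullet> X) \<and> ereal (A i \<bullet> X) \<le> bu i}"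

definition kl_feasible ::
  "nat \<Rightarrow> real \<Rightarrow> nat \<Rightarrow> (nat \<Rightarrow> real^'n^'n) \<Rightarrow> (nat \<Rightarrow> ereal) \<Rightarrow> (nat \<Rightarrow> ereal) \<Rightarrow>
     (real \<times> (real^'n^'n)) set" where
  "kl_feasible k \<alpha> m A bl bu =
     {(z, X). X \<in> kl_domain k \<alpha> z \<and> X \<in> linear_constraints m A bl bu}"

definition klr_feasible ::
  "nat \<Rightarrow> real \<Rightarrow> nat \<Rightarrow> (nat \<Rightarrow> real^'n^'n) \<Rightarrow> (nat \<Rightarrow> ereal) \<Rightarrow> (nat \<Rightarrow> ereal) \<Rightarrow>
     (real \<times> (real^'n^'n)) set" where
  "klr_feasible k \<alpha> m A bl bu =
     {(z, X). X \<in> convex hull (kl_domain k \<alpha> z) \<and> X \<in> linear_constraints m A bl bu}"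

text \<open>
  Optimal values are extended real infima: \<open>\<infinity>\<close> for an infeasible and \<open>-\<infinity>\<close> for an unbounded
  minimization problem.
\<close>

definition optimal_value :: "('a \<Rightarrow> real) \<Rightarrow> 'a set \<Rightarrow> ereal" where
  "optimal_value f F = (INF x\<in>F. ereal (f x))"

abbreviation optimal_solution :: "('a \<Rightarrow> real) \<Rightarrow> 'a set \<Rightarrow> 'a \<Rightarrow> bool" where
  "optimal_solution f F x \<equiv> is_arg_min f (\<lambda>y. y \<in> F) x"

end

theory Submission
  imports Defs
begin

text \<open>
Write \<open>D(z)\<close> for the set of positive semidefinite matrices of rank at most \<open>k\<close> whose shifted
log-determinant is at least \<open>z\<close>. Everything rests on an explicit formula for the largest level
\<open>z\<close> with \<open>X \<in> conv D(z)\<close>. Let \<open>X\<close> have the eigenvalues \<open>\<theta>\<^sub>b \<ge> 0\<close>. Choose a cap \<open>t \<ge> 0\<close> with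
\<open>\<Sum> min(\<theta>\<^sub>b, t) = k t\<close>, with \<open>t = 0\<close> only if the rank is at most \<open>k\<close> (\<open>cap_exists\<close>). If \<open>t > 0\<close>, then
the eigenvalues below \<open>t\<close> have the same sum as \<open>k - p\<close> copies of \<open>t\<close>, where \<open>p\<close> is the number of
eigenvalues at least \<open>t\<close>, and the level of \<open>X\<close> is the shifted log-determinant of the rank \<open>k\<close> matrix
with the eigenvalues \<open>\<theta>\<^sub>b \<ge> t\<close> and \<open>k - p\<close> copies of \<open>t\<close>. If \<open>t = 0\<close>, it is the shifted
log-determinant of \<open>X\<close> itself. In both cases this is \<open>cap_value\<close>.

That the level is reached (\<open>cap_value_attained\<close>) is the fact that a point of the hypersimplex is
a convex combination of 0-1 vectors: the part of \<open>X\<close> with eigenvalues below \<open>t\<close> is an average of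
\<open>t\<close> times projections of rank \<open>k - p\<close>. That it cannot be exceeded (\<open>cap_value_supports\<close>) follows
from Klein's inequality, the first-order concavity bound for the log-determinant. It even gives an
affine function of \<open>Z\<close> that dominates every level \<open>z\<close> with \<open>Z \<in> conv D(z)\<close> and is tight at \<open>X\<close>.
Hence the set of all \<open>(z, X)\<close> with \<open>X \<in> conv D(z)\<close> is closed and convex.

The level depends on the eigenvalues in the open interval from \<open>0\<close> to \<open>t\<close> only through their number
and their sum. So adding a small traceless symmetric matrix supported on the corresponding
eigenspace leaves \<open>X\<close> in \<open>conv D(z)\<close> (\<open>block_perturbation\<close>). If the rank is \<open>k + s\<close> with \<open>s > 0\<close>, this
eigenspace has dimension at least \<open>s + 1\<close>, and the symmetric matrices on it form a space of
dimension at least \<open>(s + 1) (s + 2) / 2\<close>. Fix \<open>z\<close>, the trace of \<open>X\<close> and all \<open>\<langle>A\<^sub>i, X\<rangle>\<close>, and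
minimize a linear function over the remaining compact slice of \<open>conv D(z)\<close>. At an extreme minimizer
no nonzero perturbation can be orthogonal to the identity and to all \<open>A\<^sub>i\<close>, so
\<open>(s + 1) (s + 2) / 2 \<le> mt + 1\<close>, that is \<open>s (s + 3) \<le> 2 mt\<close> (\<open>rank_reduction\<close>). This is the rank
bound, and for \<open>mt \<le> 1\<close> it forces \<open>s = 0\<close>. As matrices of rank at most \<open>k\<close> in \<open>conv D(z)\<close> belong to
\<open>D(z)\<close> (\<open>hull_kl_domain_low_rank\<close>), every feasible point of the relaxation can then be replaced by a
feasible point of the original problem that is at least as good, which proves equality of the
optimal values, finite or not.

There remains the existence of an optimal solution (\<open>relaxation_attained\<close>). If a sublevel set of the
relaxation were unbounded, it would contain a ray. Along it the level grows slower than any positive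
multiple of the trace, so the linear part of the objective has to be constant there. But the trace
tends to infinity, hence so does the best level, and the problem would be unbounded.
\<close>

section \<open>Matrices diagonal in an orthonormal basis\<close>

text \<open>
A basis is a set of vectors rather than an indexed family, so that eigenbases of complementary
invariant subspaces can be joined by union.
\<close>

definition orthonormal_basis :: "(real^'n) set \<Rightarrow> bool" where
  "orthonormal_basis B \<longleftrightarrow> (\<forall>b\<in>B. \<forall>c\<in>B. b \<bullet> c = (if b = c then 1 else 0)) \<and> span B = UNIV"

definition outer :: "real^'n \<Rightarrow> real^'n \<Rightarrow> real^'n^'n" where
  "outer u v = (\<chi> i j. u $ i * v $ j)"

definition spectral_sum :: "(real^'n) set \<Rightarrow> (real^'n \<Rightarrow> real) \<Rightarrow> real^'n^'n" where
  "spectral_sum B \<theta> = (\<Sum>b\<in>B. \<theta> b *\<^sub>R outer b b)"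

lemma inner_outer: "X \<bullet> outer u v = u \<bullet> (X *v v)"
  by (simp add: outer_def inner_vec_def matrix_vector_mult_def sum_distrib_left mult_ac)

lemma outer_mult_vec: "outer u v *v w = (v \<bullet> w) *\<^sub>R u"
  by (simp add: outer_def vec_eq_iff inner_vec_def matrix_vector_mult_def sum_distrib_right sum_distrib_left mult_ac)

lemma inner_outer_outer: "outer a b \<bullet> outer c d = (a \<bullet> c) * (b \<bullet> d)"
  by (simp add: inner_outer outer_mult_vec inner_commute)

lemma transpose_outer: "transpose (outer u v) = outer v u"
  by (simp add: transpose_def outer_def vec_eq_iff mult.commute)

lemma sum_matrix_vector_mult: "(\<Sum>i\<in>I. F i) *v v = (\<Sum>i\<in>I. F i *v v)"
  for F :: "'a \<Rightarrow> real^'n^'m"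
  by (induction I rule: infinite_finite_induct) (auto simp: matrix_vector_mult_add_rdistrib)

lemma transpose_sum: "transpose (\<Sum>i\<in>I. F i) = (\<Sum>i\<in>I. transpose (F i))"
  for F :: "'a \<Rightarrow> real^'n^'m"
  by (simp add: transpose_def vec_eq_iff)

lemma transpose_add: "transpose (X + Z) = transpose X + transpose Z"
  for X :: "real^'n^'m"
  by (simp add: transpose_def vec_eq_iff)

lemma transpose_scaleR: "transpose (c *\<^sub>R X) = c *\<^sub>R transpose X"
  for X :: "real^'n^'m"
  by (simp add: transpose_def vec_eq_iff)

lemma spectral_sum_mult_vec: "spectral_sum B \<theta> *v v = (\<Sum>b\<in>B. (\<theta> b * (b \<bullet> v)) *\<^sub>R b)"
  by (simp add: spectral_sum_def sum_matrix_vector_mult outer_mult_vec scaleR_matrix_vector_assoc [symmetric])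

lemma spectral_sum_quadratic: "v \<bullet> (spectral_sum B \<theta> *v v) = (\<Sum>b\<in>B. \<theta> b * (b \<bullet> v)\<^sup>2)"
  by (simp add: spectral_sum_mult_vec inner_sum_right power2_eq_square inner_commute mult_ac)

lemma psd_spectral_sum: "(\<And>b. b \<in> B \<Longrightarrow> 0 \<le> \<theta> b) \<Longrightarrow> psd (spectral_sum B \<theta>)"
  unfolding psd_def spectral_sum_quadratic
  by (auto simp: spectral_sum_def transpose_sum transpose_scaleR transpose_outer intro!: sum_nonneg)

lemma inner_spectral_sum: "X \<bullet> spectral_sum B \<theta> = (\<Sum>b\<in>B. \<theta> b * (b \<bullet> (X *v b)))"
  by (simp add: spectral_sum_def inner_sum_right inner_outer)

lemma spectral_sum_cong: "(\<And>b. b \<in> B \<Longrightarrow> \<theta> b = \<mu> b) \<Longrightarrow> spectral_sum B \<theta> = spectral_sum B \<mu>"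
  by (simp add: spectral_sum_def)

lemma spectral_sum_add:
  "spectral_sum B (\<lambda>b. \<theta> b + \<mu> b) = spectral_sum B \<theta> + spectral_sum B \<mu>"
  by (simp add: spectral_sum_def scaleR_add_left sum.distrib)

lemma spectral_sum_mult_left: "spectral_sum B (\<lambda>b. c * \<theta> b) = c *\<^sub>R spectral_sum B \<theta>"
  by (simp add: spectral_sum_def scaleR_sum_right)

context
  fixes B :: "(real^'n) set"
  assumes B: "orthonormal_basis B"
begin

lemma onb_inner: "b \<in> B \<Longrightarrow> c \<in> B \<Longrightarrow> b \<bullet> c = (if b = c then 1 else 0)"
  using B unfolding orthonormal_basis_def by blast

lemma onb_span: "span B = UNIV"
  using B unfolding orthonormal_basis_def by blast

lemma onb_independent: "independent B"
  by (rule pairwise_orthogonal_independent)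
    (use onb_inner in \<open>fastforce simp: pairwise_def orthogonal_def\<close>)+

lemma onb_finite: "finite B"
  using onb_independent by (rule independent_imp_finite)

lemma onb_card: "card B = CARD('n)"
  using dim_eq_card_independent[OF onb_independent] onb_span dim_span[of B] by simp

lemma onb_eigenvectors: "c \<in> B \<Longrightarrow> spectral_sum B \<theta> *v c = \<theta> c *\<^sub>R c"
  by (simp add: spectral_sum_mult_vec onb_inner onb_finite if_distrib if_distribR sum.delta cong: if_cong)

lemma matrix_eq_on_onb:
  fixes X Z :: "real^'n^'m"
  assumes "\<And>b. b \<in> B \<Longrightarrow> X *v b = Z *v b"
  shows "X = Z"
proof -
  have "X *v v = Z *v v" for v
    by (rule linear_eq_on_span[of "(*v) X" "(*v) Z" B]) (use assms onb_span in auto)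
  then show ?thesis by (simp add: matrix_eq)
qed

lemma eq_spectral_sum:
  assumes "\<And>b. b \<in> B \<Longrightarrow> X *v b = \<theta> b *\<^sub>R b"
  shows "X = spectral_sum B \<theta>"
  by (rule matrix_eq_on_onb) (simp add: assms onb_eigenvectors)

lemma spectral_sum_const: "spectral_sum B (\<lambda>b. c) = c *\<^sub>R mat 1"
  by (rule eq_spectral_sum [symmetric]) (simp add: scaleR_matrix_vector_assoc [symmetric])

lemma onb_parseval: "(\<Sum>b\<in>B. (b \<bullet> v)\<^sup>2) = v \<bullet> v"
  using spectral_sum_quadratic[of v B "\<lambda>_. 1"] spectral_sum_const[of 1] by simp

lemma inner_spectral_sums:
  "spectral_sum B \<theta> \<bullet> spectral_sum B \<mu> = (\<Sum>b\<in>B. \<theta> b * \<mu> b)"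
  unfolding inner_spectral_sum
  by (rule sum.cong) (auto simp: onb_eigenvectors onb_inner)

text \<open>
The vectors of \<open>B\<close>, enumerated as the columns of a matrix, form an orthogonal matrix, which conjugates
the spectral sum to a diagonal matrix.
\<close>

lemma det_spectral_sum: "det (spectral_sum B \<theta>) = (\<Prod>b\<in>B. \<theta> b)"
proof -
  obtain f :: "'n \<Rightarrow> real^'n" where f: "bij_betw f UNIV B"
    using onb_card onb_finite by (metis finite_same_card_bij finite)
  define U :: "real^'n^'n" where "U = (\<chi> i j. f j $ i)"
  define D :: "real^'n^'n" where "D = (\<chi> i j. if i = j then \<theta> (f i) else 0)"
  have ff: "f i \<bullet> f j = (if i = j then 1 else 0)" for i j
    using f onb_inner[of "f i" "f j"] by (auto simp: bij_betw_def inj_on_def)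
  have UU: "transpose U ** U = mat 1"
    using ff by (auto simp: U_def matrix_matrix_mult_def transpose_def mat_def vec_eq_iff inner_vec_def)
  have "spectral_sum B \<theta> = (\<Sum>i\<in>UNIV. \<theta> (f i) *\<^sub>R outer (f i) (f i))"
    unfolding spectral_sum_def by (rule sum.reindex_bij_betw[OF f, symmetric])
  also have "\<dots> = U ** D ** transpose U"
    by (simp add: U_def D_def matrix_matrix_mult_def transpose_def outer_def vec_eq_iff
        if_distrib if_distribR sum.delta mult_ac cong: if_cong)
  finally have "det (spectral_sum B \<theta>) = det U * det D * det (transpose U)"
    by (simp add: det_mul)
  also have "\<dots> = det (transpose U ** U) * det D"
    by (simp add: det_mul)
  also have "\<dots> = (\<Prod>i\<in>UNIV. \<theta> (f i))"
    unfolding UU by (simp add: det_diagonal D_def)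
  also have "\<dots> = (\<Prod>b\<in>B. \<theta> b)"
    by (rule prod.reindex_bij_betw[OF f])
  finally show ?thesis .
qed

text \<open>
The range of the matrix is spanned by the eigenvectors with nonzero eigenvalue.
\<close>

lemma rank_spectral_sum: "rank (spectral_sum B \<theta>) = card {b\<in>B. \<theta> b \<noteq> 0}"
proof -
  let ?S = "{b\<in>B. \<theta> b \<noteq> 0}" and ?R = "range (\<lambda>x. spectral_sum B \<theta> *v x)"
  have "spectral_sum B \<theta> *v v \<in> span ?S" for v
    unfolding spectral_sum_mult_vec
    by (rule span_sum) (metis (mono_tags, lifting) mem_Collect_eq mult_zero_left scale_zero_left span_base span_scale span_zero)
  then have 1: "?R \<subseteq> span ?S" by auto
  have "b \<in> ?R" if "b \<in> ?S" for b
    using that onb_eigenvectors[of b \<theta>]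
    by (intro range_eqI[where x = "(1 / \<theta> b) *\<^sub>R b"]) (simp add: matrix_vector_mult_scaleR)
  then have 2: "?S \<subseteq> ?R" by auto
  have "independent ?S" using onb_independent by (rule independent_mono) auto
  then show ?thesis
    using dim_subset[OF 1] dim_subset[OF 2] dim_eq_card_independent[of ?S]
    by (simp add: rank_dim_range)
qed

end

lemma logdet_spectral_sum:
  assumes "orthonormal_basis B" "\<And>b. b \<in> B \<Longrightarrow> 0 < \<theta> b"
  shows "logdet (spectral_sum B \<theta>) = (\<Sum>b\<in>B. ln (\<theta> b))"
  unfolding logdet_def det_spectral_sum[OF assms(1)]
  by (rule ln_prod) (use assms onb_finite in \<open>force+\<close>)

lemma logdet_shifted_spectral_sum:
  assumes "orthonormal_basis B" "\<And>b. b \<in> B \<Longrightarrow> 0 \<le> \<theta> b" "0 < \<alpha>"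
  shows "logdet (spectral_sum B \<theta> + \<alpha> *\<^sub>R mat 1) = (\<Sum>b\<in>B. ln (\<theta> b + \<alpha>))"
proof -
  have "spectral_sum B \<theta> + \<alpha> *\<^sub>R mat 1 = spectral_sum B (\<lambda>b. \<theta> b + \<alpha>)"
    by (simp add: spectral_sum_add spectral_sum_const[OF assms(1)])
  with assms show ?thesis
    by (simp add: logdet_spectral_sum add_nonneg_pos)
qed

section \<open>The spectral theorem on invariant subspaces\<close>

lemma symmetric_inner: "transpose X = X \<Longrightarrow> v \<bullet> (X *v w) = w \<bullet> (X *v v)"
  for X :: "real^'n^'n"
  by (metis dot_lmul_matrix inner_commute transpose_matrix_vector)

text \<open>
Take an orthonormal system of eigenvectors in \<open>V\<close> that is as large as possible. On the orthogonal
complement \<open>W\<close> of the system inside \<open>V\<close>, which is again invariant, a unit vector maximizing the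
Rayleigh quotient is an eigenvector and would enlarge the system; so \<open>W\<close> is trivial. The relative
version is needed to diagonalize a perturbation of a single block without touching the rest.
\<close>

lemma spectral_theorem_subspace:
  fixes X :: "real^'n^'n"
  assumes X: "transpose X = X" and V: "subspace V" and inv: "\<And>v. v \<in> V \<Longrightarrow> X *v v \<in> V"
  obtains B where "B \<subseteq> V" "span B = V" "finite B" "card B = dim V"
    "\<forall>b\<in>B. \<forall>c\<in>B. b \<bullet> c = (if b = c then 1 else 0)"
    "\<And>b. b \<in> B \<Longrightarrow> X *v b = (b \<bullet> (X *v b)) *\<^sub>R b"
proof -
  let ?onv = "\<lambda>B. B \<subseteq> V \<and> (\<forall>b\<in>B. \<forall>c\<in>B. b \<bullet> c = (if b = c then 1 else 0)) \<and>
    (\<forall>b\<in>B. X *v b = (b \<bullet> (X *v b)) *\<^sub>R b)"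
  have indep: "independent B \<and> finite B" if "?onv B" for B
  proof -
    have "independent B"
      by (rule pairwise_orthogonal_independent) (use that in \<open>fastforce simp: pairwise_def orthogonal_def\<close>)+
    then show ?thesis by (simp add: independent_imp_finite)
  qed
  have "\<forall>B. ?onv B \<longrightarrow> card B < Suc (DIM(real^'n))"
    using indep independent_card_le less_Suc_eq_le by blast
  moreover have "?onv {}" by simp
  ultimately have "\<exists>B. ?onv B \<and> (\<forall>C. ?onv C \<longrightarrow> card C \<le> card B)"
    by (intro ex_has_greatest_nat)
  then obtain B where B: "?onv B" and max: "\<And>C. ?onv C \<Longrightarrow> card C \<le> card B"
    by blast
  define W where "W = {w\<in>V. \<forall>b\<in>B. b \<bullet> w = 0}"
  have W: "subspace W"
    using V by (auto simp: W_def subspace_def inner_add_right)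
  have "w = 0" if w: "w \<in> W" for w
  proof (rule ccontr)
    assume "w \<noteq> 0"
    let ?S = "W \<inter> sphere 0 1"
    have "compact ?S"
      by (simp add: closed_Int_compact closed_subspace W)
    moreover have "?S \<noteq> {}"
    proof -
      have "(1 / norm w) *\<^sub>R w \<in> ?S"
        using w \<open>w \<noteq> 0\<close> W by (simp add: subspace_scale)
      then show ?thesis by blast
    qed
    moreover have "continuous_on ?S (\<lambda>v. v \<bullet> (X *v v))"
      by (intro continuous_intros linear_continuous_on) (simp add: linear_linear)
    ultimately obtain v where v: "v \<in> W" "norm v = 1"
      and vmax: "\<And>u. u \<in> W \<Longrightarrow> norm u = 1 \<Longrightarrow> u \<bullet> (X *v u) \<le> v \<bullet> (X *v v)"
      using continuous_attains_sup[of ?S "\<lambda>v. v \<bullet> (X *v v)"]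
      by (metis IntD1 IntD2 IntI mem_sphere_0)
    define \<mu> where "\<mu> = v \<bullet> (X *v v)"
    have bound: "u \<bullet> (X *v u) \<le> \<mu> * (u \<bullet> u)" if "u \<in> W" for u
    proof (cases "u = 0")
      case False
      have "((1 / norm u) *\<^sub>R u) \<bullet> (X *v ((1 / norm u) *\<^sub>R u)) \<le> \<mu>"
        unfolding \<mu>_def using that False W by (intro vmax) (auto simp: subspace_scale)
      then show ?thesis
        using False by (simp add: matrix_vector_mult_scaleR field_simps power2_norm_eq_inner[symmetric] power2_eq_square)
    qed simp
    have XW: "X *v u \<in> W" if "u \<in> W" for u
      unfolding W_def
    proof (intro CollectI conjI ballI)
      show "X *v u \<in> V" using that inv by (simp add: W_def)
      fix b assume b: "b \<in> B"
      have "b \<bullet> (X *v u) = u \<bullet> (X *v b)" by (rule symmetric_inner[OF X])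
      also have "\<dots> = u \<bullet> ((b \<bullet> (X *v b)) *\<^sub>R b)" using B b by simp
      also have "\<dots> = 0" using that b by (simp add: W_def inner_commute)
      finally show "b \<bullet> (X *v u) = 0" .
    qed
    \<comment> \<open>The residual of the eigenvalue equation is itself an admissible direction of variation; the
      first-order term of the Rayleigh quotient in this direction is twice its squared norm.\<close>
    define w' where "w' = X *v v - \<mu> *\<^sub>R v"
    have w': "w' \<in> W" unfolding w'_def using v XW W by (simp add: subspace_diff subspace_scale)
    have vv: "v \<bullet> v = 1" using v by (simp add: norm_eq_1)
    have w'v: "w' \<bullet> v = 0"
      unfolding inner_commute[of w' v] by (simp add: w'_def inner_diff_right vv \<mu>_def)
    have w'Xv: "w' \<bullet> (X *v v) = w' \<bullet> w'"
      using w'v by (simp add: w'_def inner_diff_right)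
    define q where "q = w' \<bullet> (X *v w')"
    have "2 * s * (w' \<bullet> w') \<le> s\<^sup>2 * (\<mu> * (w' \<bullet> w') - q)" for s
    proof -
      have "v + s *\<^sub>R w' \<in> W" using v w' W by (simp add: subspace_add subspace_scale)
      then have "(v + s *\<^sub>R w') \<bullet> (X *v (v + s *\<^sub>R w')) \<le> \<mu> * ((v + s *\<^sub>R w') \<bullet> (v + s *\<^sub>R w'))"
        by (rule bound)
      also have "(v + s *\<^sub>R w') \<bullet> (v + s *\<^sub>R w') = 1 + s\<^sup>2 * (w' \<bullet> w')"
        using w'v by (simp add: inner_add_left inner_add_right vv inner_commute power2_eq_square)
      also have "(v + s *\<^sub>R w') \<bullet> (X *v (v + s *\<^sub>R w')) = \<mu> + 2 * s * (w' \<bullet> w') + s\<^sup>2 * q"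
        using symmetric_inner[OF X, of v w'] w'Xv
        by (simp add: matrix_vector_right_distrib matrix_vector_mult_scaleR inner_add_left inner_add_right
            \<mu>_def q_def power2_eq_square algebra_simps)
      finally show ?thesis by (simp add: algebra_simps)
    qed
    note * = this
    define N where "N = w' \<bullet> w'"
    have "N = 0"
    proof (rule ccontr)
      assume "N \<noteq> 0"
      then have N: "N > 0" unfolding N_def by simp
      define R where "R = \<bar>\<mu> * N - q\<bar> + 1"
      have R: "R > 0" "\<mu> * N - q \<le> R" unfolding R_def by auto
      have "2 * (N / R) * N \<le> (N / R)\<^sup>2 * (\<mu> * N - q)" using *[of "N / R"] by (simp add: N_def)
      also have "\<dots> \<le> (N / R)\<^sup>2 * R" by (rule mult_left_mono[OF R(2)]) simp
      also have "\<dots> = (N / R) * N" using R by (simp add: power2_eq_square)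
      finally have "N / R * N \<le> 0" by simp
      moreover have "N / R * N > 0" using N R by simp
      ultimately show False by simp
    qed
    then have Xv: "X *v v = (v \<bullet> (X *v v)) *\<^sub>R v" by (simp add: N_def w'_def \<mu>_def)
    have "v \<notin> B" using v(1) vv by (auto simp: W_def)
    moreover have "?onv (insert v B)"
      using B v(1) vv Xv unfolding W_def by (auto simp: inner_commute)
    ultimately show False using max[of "insert v B"] indep[OF B] by simp
  qed
  note W0 = this
  have spanB: "span B = V"
  proof
    show "span B \<subseteq> V" using B V by (simp add: span_minimal)
    show "V \<subseteq> span B"
    proof
      fix x assume x: "x \<in> V"
      obtain y z where yz: "y \<in> span B" "\<And>w. w \<in> span B \<Longrightarrow> orthogonal z w" "x = y + z"
        using orthogonal_subspace_decomp_exists[of B x] by metis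
      have "z = x - y" using yz by simp
      then have "z \<in> V" using x yz(1) \<open>span B \<subseteq> V\<close> V by (auto simp: subspace_diff)
      moreover have "\<forall>b\<in>B. b \<bullet> z = 0" using yz(2) by (auto simp: orthogonal_def inner_commute span_base)
      ultimately have "z = 0" using W0[of z] by (auto simp: W_def)
      then show "x \<in> span B" using yz by simp
    qed
  qed
  have "card B = dim V"
    using spanB indep[OF B] dim_eq_card_independent dim_span by metis
  then show ?thesis
    using that[of B] spanB indep[OF B] B by auto
qed

lemma spectral_theorem:
  fixes X :: "real^'n^'n"
  assumes "transpose X = X"
  obtains B where "orthonormal_basis B" "X = spectral_sum B (\<lambda>b. b \<bullet> (X *v b))"
proof (rule spectral_theorem_subspace[OF assms subspace_UNIV])
  fix B assume B: "span B = UNIV" "\<forall>b\<in>B. \<forall>c\<in>B. b \<bullet> c = (if b = c then 1 else 0)"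
    "\<And>b. b \<in> B \<Longrightarrow> X *v b = (b \<bullet> (X *v b)) *\<^sub>R b"
  then have onb: "orthonormal_basis B" by (simp add: orthonormal_basis_def)
  show thesis
    by (rule that[OF onb eq_spectral_sum[OF onb B(3)]])
qed simp

lemma psd_spectral_decomposition:
  fixes X :: "real^'n^'n"
  assumes "psd X"
  obtains B \<theta> where "orthonormal_basis B" "\<And>b. 0 \<le> \<theta> b" "X = spectral_sum B \<theta>"
proof (rule spectral_theorem[of X])
  show "transpose X = X" using assms by (simp add: psd_def)
  fix B assume "orthonormal_basis B" "X = spectral_sum B (\<lambda>b. b \<bullet> (X *v b))"
  then show thesis
    using assms by (intro that[of B "\<lambda>b. b \<bullet> (X *v b)"]) (auto simp: psd_def)
qed

section \<open>Klein's inequality\<close>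

lemma psd_inner_nonneg:
  fixes X Z :: "real^'n^'n"
  assumes "psd X" "psd Z"
  shows "0 \<le> X \<bullet> Z"
proof (rule psd_spectral_decomposition[OF assms(2)])
  fix B and \<theta> :: "real^'n \<Rightarrow> real"
  assume "\<And>b. 0 \<le> \<theta> b" "Z = spectral_sum B \<theta>"
  then show ?thesis
    using assms(1) by (auto simp: inner_spectral_sum psd_def intro!: sum_nonneg)
qed

lemma spectral_sum_inner_spectral_sum:
  "spectral_sum B \<theta> \<bullet> spectral_sum C \<mu> = (\<Sum>c\<in>C. \<Sum>b\<in>B. (b \<bullet> c)\<^sup>2 * (\<theta> b * \<mu> c))"
  by (simp add: inner_spectral_sum spectral_sum_quadratic sum_distrib_left mult_ac)

text \<open>
For positive definite \<open>H\<close> and \<open>N\<close> this is \<open>ln det N \<le> ln det H + \<langle>inverse H, N\<rangle> - n\<close>, the tangent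
inequality of the concave log-determinant at \<open>H\<close>. The squared inner products of two orthonormal
bases form a doubly stochastic matrix, so averaging the scalar inequality \<open>ln x \<le> x - 1\<close> for
\<open>x = \<nu>\<^sub>c / h\<^sub>b\<close> with these weights suffices.
\<close>

lemma klein_inequality:
  fixes B C :: "(real^'n) set"
  assumes B: "orthonormal_basis B" and C: "orthonormal_basis C"
    and h: "\<And>b. b \<in> B \<Longrightarrow> 0 < h b" and \<nu>: "\<And>c. c \<in> C \<Longrightarrow> 0 < \<nu> c"
  shows "(\<Sum>c\<in>C. ln (\<nu> c)) \<le>
    (\<Sum>b\<in>B. ln (h b)) + spectral_sum B (\<lambda>b. 1 / h b) \<bullet> spectral_sum C \<nu> - CARD('n)"
proof -
  let ?w = "\<lambda>b c. (b \<bullet> c)\<^sup>2"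
  have wB: "(\<Sum>b\<in>B. ?w b c) = 1" if "c \<in> C" for c
    using onb_parseval[OF B, of c] onb_inner[OF C that that] by simp
  have wC: "(\<Sum>c\<in>C. ?w b c) = 1" if "b \<in> B" for b
    using onb_parseval[OF C, of b] onb_inner[OF B that that] by (simp add: inner_commute)
  have "(\<Sum>c\<in>C. ln (\<nu> c)) = (\<Sum>c\<in>C. (\<Sum>b\<in>B. ?w b c) * ln (\<nu> c))"
    using wB by simp
  also have "\<dots> = (\<Sum>c\<in>C. \<Sum>b\<in>B. ?w b c * ln (\<nu> c))"
    by (simp add: sum_distrib_right)
  also have "\<dots> \<le> (\<Sum>c\<in>C. \<Sum>b\<in>B. ?w b c * (ln (h b) + 1 / h b * \<nu> c - 1))"
  proof (intro sum_mono mult_left_mono)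
    fix b c assume "b \<in> B" "c \<in> C"
    then have pos: "0 < h b" "0 < \<nu> c" using h \<nu> by auto
    then show "ln (\<nu> c) \<le> ln (h b) + 1 / h b * \<nu> c - 1"
      using ln_le_minus_one[of "\<nu> c / h b"] by (simp add: ln_div)
  qed simp
  also have "\<dots> = (\<Sum>c\<in>C. \<Sum>b\<in>B. ?w b c * ln (h b)) +
      (\<Sum>c\<in>C. \<Sum>b\<in>B. ?w b c * (1 / h b * \<nu> c)) - (\<Sum>c\<in>C. \<Sum>b\<in>B. ?w b c)"
    by (simp only: distrib_left right_diff_distrib sum.distrib sum_subtractf mult_1_right)
  also have "(\<Sum>c\<in>C. \<Sum>b\<in>B. ?w b c) = CARD('n)"
    using wB onb_card[OF C] by simp
  also have "(\<Sum>c\<in>C. \<Sum>b\<in>B. ?w b c * ln (h b)) = (\<Sum>b\<in>B. ln (h b))"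
  proof -
    have "(\<Sum>c\<in>C. \<Sum>b\<in>B. ?w b c * ln (h b)) = (\<Sum>b\<in>B. (\<Sum>c\<in>C. ?w b c) * ln (h b))"
      by (subst sum.swap) (simp add: sum_distrib_right)
    then show ?thesis using wC by simp
  qed
  finally show ?thesis
    by (simp add: spectral_sum_inner_spectral_sum)
qed

section \<open>Points of the hypersimplex\<close>

text \<open>
Vectors with entries in the unit interval and integral sum \<open>q\<close> are convex combinations of 0-1 vectors
with \<open>q\<close> ones. By integrality, one fractional entry implies a second one. Shifting weight between the
two, in either direction, until one of them becomes integral writes the vector as a convex
combination of two vectors with fewer fractional entries.
\<close>

lemma hypersimplex_convex_hull:
  fixes M :: "'a \<Rightarrow> 'v::real_vector" and c :: "'a \<Rightarrow> real"
  assumes "finite J" and "\<And>j. j \<in> J \<Longrightarrow> 0 \<le> c j \<and> c j \<le> 1" and "sum c J = real q"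
  shows "(\<Sum>j\<in>J. c j *\<^sub>R M j) \<in> convex hull {\<Sum>j\<in>T. M j | T. T \<subseteq> J \<and> card T = q}"
    (is "_ \<in> convex hull ?V")
  using assms(2,3)
proof (induction "card {j\<in>J. 0 < c j \<and> c j < 1}" arbitrary: c rule: less_induct)
  case less
  note J = \<open>finite J\<close>
  let ?F = "\<lambda>c. {j\<in>J. 0 < c j \<and> (c j::real) < 1}"
  have integral: "(\<Sum>j\<in>A. c j) = card {j\<in>A. c j = 1}" if "A \<subseteq> J" "A \<inter> ?F c = {}" for A
  proof -
    have fin: "finite A" using J that by (auto dest: finite_subset)
    have "(\<Sum>j\<in>A. c j) = (\<Sum>j\<in>A. if c j = 1 then 1 else 0)"
      using that less.prems(1) by (intro sum.cong) (auto simp: subset_iff, force)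
    then show ?thesis using fin by (simp add: sum.inter_filter[symmetric])
  qed
  show ?case
  proof (cases "?F c = {}")
    case True
    let ?T = "{j\<in>J. c j = 1}"
    have "(\<Sum>j\<in>J. c j *\<^sub>R M j) = (\<Sum>j\<in>J. if c j = 1 then M j else 0)"
      using True less.prems(1) by (intro sum.cong) (auto, force)
    also have "\<dots> = (\<Sum>j\<in>?T. M j)"
      using J by (simp add: sum.inter_filter)
    finally have "(\<Sum>j\<in>J. c j *\<^sub>R M j) = (\<Sum>j\<in>?T. M j)" .
    moreover have "card ?T = q"
      using integral[of J] True less.prems(2) by simp
    ultimately show ?thesis by (intro hull_inc) blast
  next
    case False
    then obtain i where i: "i \<in> ?F c" by blast
    obtain j where j: "j \<in> ?F c" "j \<noteq> i"
    proof (rule ccontr)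
      assume "\<not> thesis"
      then have "(J - {i}) \<inter> ?F c = {}" using that by blast
      then have "sum c (J - {i}) = card {j \<in> J - {i}. c j = 1}" by (intro integral) auto
      then have "c i = of_int (int q - int (card {j \<in> J - {i}. c j = 1}))"
        using less.prems(2) i J by (simp add: sum.remove[of J i])
      then have "c i \<in> \<int>" using Ints_of_int by metis
      then obtain r where r: "c i = of_int r" by (rule Ints_cases)
      with i have "0 < r" "r < 1" by auto
      then show False by simp
    qed
    define sh where "sh a x = c x + (if x = i then a else 0) - (if x = j then a else 0)" for a x
    have sh_sum: "(\<Sum>x\<in>J. sh a x *\<^sub>R M x) = (\<Sum>x\<in>J. c x *\<^sub>R M x) + a *\<^sub>R (M i - M j)" for a
    proof -
      have "(\<Sum>x\<in>J. sh a x *\<^sub>R M x) = (\<Sum>x\<in>J. c x *\<^sub>R M x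
          + (if x = i then a *\<^sub>R M i else 0) - (if x = j then a *\<^sub>R M j else 0))"
        by (intro sum.cong) (auto simp: sh_def scaleR_add_left scaleR_diff_left)
      then show ?thesis
        using i j J by (simp add: sum.distrib sum_subtractf scaleR_diff_right)
    qed
    have step: "(\<Sum>x\<in>J. sh a x *\<^sub>R M x) \<in> convex hull ?V"
      if a: "0 \<le> c i + a" "c i + a \<le> 1" "0 \<le> c j - a" "c j - a \<le> 1"
        "\<not> (0 < c i + a \<and> c i + a < 1 \<and> 0 < c j - a \<and> c j - a < 1)" for a
    proof (rule less.hyps)
      have sub: "?F (sh a) \<subseteq> ?F c"
        using i j by (auto simp: sh_def split: if_splits)
      have "\<not> (i \<in> ?F (sh a) \<and> j \<in> ?F (sh a))"
        using a j by (auto simp: sh_def)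
      then have "?F (sh a) \<noteq> ?F c" using i j by blast
      then show "card (?F (sh a)) < card (?F c)"
        using sub J by (intro psubset_card_mono) auto
      show "0 \<le> sh a x \<and> sh a x \<le> 1" if "x \<in> J" for x
        using less.prems(1)[OF that] a j by (auto simp: sh_def)
      show "sum (sh a) J = real q"
        using i j J less.prems(2) by (simp add: sh_def sum.distrib sum_subtractf)
    qed
    \<comment> \<open>The largest shifts from \<open>j\<close> to \<open>i\<close> and from \<open>i\<close> to \<open>j\<close> that keep both entries in the unit interval.\<close>
    define a where "a = min (1 - c i) (c j)"
    define b where "b = min (c i) (1 - c j)"
    have ab: "0 < a" "0 < b" using i j by (auto simp: a_def b_def)
    let ?P = "\<Sum>x\<in>J. c x *\<^sub>R M x"
    have 1: "?P + a *\<^sub>R (M i - M j) \<in> convex hull ?V"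
      unfolding sh_sum[symmetric] by (rule step) (use i j in \<open>auto simp: a_def min_def\<close>)
    have 2: "?P + (- b) *\<^sub>R (M i - M j) \<in> convex hull ?V"
      unfolding sh_sum[symmetric] by (rule step) (use i j in \<open>auto simp: b_def min_def\<close>)
    have comb: "(b / (a + b)) *\<^sub>R (P + a *\<^sub>R D) + (a / (a + b)) *\<^sub>R (P + (- b) *\<^sub>R D) = P"
      for P D :: 'v
    proof -
      have "(b / (a + b)) *\<^sub>R (P + a *\<^sub>R D) + (a / (a + b)) *\<^sub>R (P + (- b) *\<^sub>R D) =
          ((b / (a + b)) + (a / (a + b))) *\<^sub>R P"
        by (simp add: scaleR_add_right scaleR_diff_right scaleR_add_left mult.commute)
      also have "b / (a + b) + a / (a + b) = 1"
        using ab by (simp add: add_divide_distrib[symmetric] add.commute)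
      finally show ?thesis by simp
    qed
    have "(b / (a + b)) *\<^sub>R (?P + a *\<^sub>R (M i - M j)) + (a / (a + b)) *\<^sub>R (?P + (- b) *\<^sub>R (M i - M j))
        \<in> convex hull ?V"
      by (rule convexD[OF convex_convex_hull 1 2])
        (use ab in \<open>auto simp: add_divide_distrib[symmetric] add.commute\<close>)
    then show ?thesis unfolding comb .
  qed
qed

section \<open>The largest admissible level of a positive semidefinite matrix\<close>

text \<open>
If the eigenvalues \<open>\<theta>\<close> have sum of \<open>min(\<theta>, t)\<close> equal to \<open>k t\<close>, this is the shifted log-determinant of a
matrix of rank at most \<open>k\<close> in which the eigenvalues below \<open>t\<close> have been redistributed into copies of
\<open>t\<close> and zeros: the sum counts \<open>ln (t + \<alpha>)\<close> for each of them, and the second term turns \<open>n - k\<close> of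
these into \<open>ln \<alpha>\<close>. For \<open>t = 0\<close> it is the shifted log-determinant of the matrix itself.
\<close>

definition cap_value :: "nat \<Rightarrow> real \<Rightarrow> (real^'n) set \<Rightarrow> (real^'n \<Rightarrow> real) \<Rightarrow> real \<Rightarrow> real" where
  "cap_value k \<alpha> B \<theta> t =
     (\<Sum>b\<in>B. ln (max (\<theta> b) t + \<alpha>)) - (real CARD('n) - real k) * (ln (t + \<alpha>) - ln \<alpha>)"

text \<open>
A matrix \<open>Z\<close> of rank at most \<open>k\<close> vanishes on a space of dimension \<open>n - k\<close>. Adding \<open>t\<close> times the
projection onto that space changes the log-determinant by exactly the correction term in \<open>cap_value\<close>,
and Klein's inequality can be applied with reference eigenvalues \<open>h = max(\<theta>, t) + \<alpha>\<close>. The cost of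
the projection is at most \<open>(n - k) t / (t + \<alpha>)\<close> because \<open>1 / h \<le> 1 / (t + \<alpha>)\<close>, and the choice of
the cap \<open>t\<close> is what balances it against the eigenvalues of the reference matrix below \<open>t\<close>.
\<close>

lemma cap_value_supports:
  fixes B :: "(real^'n) set" and \<theta> :: "real^'n \<Rightarrow> real" and t \<alpha> :: real
  assumes B: "orthonormal_basis B" and \<theta>: "\<And>b. 0 \<le> \<theta> b" and t: "0 \<le> t" and \<alpha>: "0 < \<alpha>"
    and k: "k \<le> CARD('n)" and cap: "(\<Sum>b\<in>B. min (\<theta> b) t) = k * t"
    and Z: "Z \<in> kl_domain k \<alpha> z"
  shows "z \<le> cap_value k \<alpha> B \<theta> t +
    spectral_sum B (\<lambda>b. 1 / (max (\<theta> b) t + \<alpha>)) \<bullet> (Z - spectral_sum B \<theta>)"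
proof -
  let ?n = "CARD('n)"
  define h where "h b = max (\<theta> b) t + \<alpha>" for b
  define G where "G = spectral_sum B (\<lambda>b. 1 / h b)"
  have h: "t + \<alpha> \<le> h b" "0 < h b" for b
    using t \<alpha> by (auto simp: h_def)
  have ta: "0 < t + \<alpha>" using t \<alpha> by simp
  have psdZ: "psd Z" and rankZ: "rank Z \<le> k" and zZ: "z \<le> logdet (Z + \<alpha> *\<^sub>R mat 1)"
    using Z by (auto simp: kl_domain_def)
  obtain C \<mu> where C: "orthonormal_basis C" and \<mu>: "\<And>c. 0 \<le> \<mu> c" and ZC: "Z = spectral_sum C \<mu>"
    using psd_spectral_decomposition[OF psdZ] by metis
  have finC: "finite C" using C by (rule onb_finite)
  have "card C = card {c\<in>C. \<mu> c = 0} + card {c\<in>C. \<mu> c \<noteq> 0}"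
    using finC by (subst card_Un_disjoint [symmetric]) (auto intro: arg_cong[where f = card])
  then have "?n - k \<le> card {c\<in>C. \<mu> c = 0}"
    using rankZ onb_card[OF C] rank_spectral_sum[OF C, of \<mu>] by (simp add: ZC)
  then obtain K where K: "K \<subseteq> {c\<in>C. \<mu> c = 0}" "card K = ?n - k" "finite K"
    by (rule obtain_subset_with_card_n)
  have CK: "{c\<in>C. c \<in> K} = K" "C \<inter> K = K" using K by auto
  have cardK: "real (card K) = real ?n - real k" using K k by simp
  define \<nu> where "\<nu> c = \<mu> c + \<alpha> + t * (if c \<in> K then 1 else 0)" for c
  have \<nu>: "0 < \<nu> c" for c
    using \<mu>[of c] \<alpha> t by (simp add: \<nu>_def)
  have "(\<Sum>c\<in>C. ln (\<nu> c)) = (\<Sum>c\<in>C. ln (\<mu> c + \<alpha>) + (if c \<in> K then ln (t + \<alpha>) - ln \<alpha> else 0))"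
    using K(1) by (intro sum.cong) (auto simp: \<nu>_def add.commute)
  also have "\<dots> = (\<Sum>c\<in>C. ln (\<mu> c + \<alpha>)) + (real ?n - real k) * (ln (t + \<alpha>) - ln \<alpha>)"
    using finC by (simp add: sum.distrib sum.If_cases CK cardK)
  finally have "(\<Sum>c\<in>C. ln (\<nu> c)) = logdet (Z + \<alpha> *\<^sub>R mat 1) + (real ?n - real k) * (ln (t + \<alpha>) - ln \<alpha>)"
    by (simp add: ZC logdet_shifted_spectral_sum[OF C _ \<alpha>] \<mu>)
  moreover have "(\<Sum>c\<in>C. ln (\<nu> c)) \<le> (\<Sum>b\<in>B. ln (h b)) + G \<bullet> spectral_sum C \<nu> - ?n"
    unfolding G_def by (rule klein_inequality[OF B C h(2) \<nu>])
  moreover have "G \<bullet> spectral_sum C \<nu> \<le> G \<bullet> Z + (\<Sum>b\<in>B. \<alpha> / h b) + (real ?n - real k) * (t / (t + \<alpha>))"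
  proof -
    have "spectral_sum C \<nu> = Z + \<alpha> *\<^sub>R mat 1 + t *\<^sub>R spectral_sum C (\<lambda>c. if c \<in> K then 1 else 0)"
      by (simp add: \<nu>_def[abs_def] spectral_sum_add spectral_sum_mult_left spectral_sum_const[OF C] ZC)
    then have "G \<bullet> spectral_sum C \<nu> = G \<bullet> Z + G \<bullet> (\<alpha> *\<^sub>R mat 1) +
        t * (G \<bullet> spectral_sum C (\<lambda>c. if c \<in> K then 1 else 0))"
      by (simp add: inner_add_right)
    moreover have "G \<bullet> (\<alpha> *\<^sub>R mat 1) = (\<Sum>b\<in>B. \<alpha> / h b)"
      unfolding spectral_sum_const[OF B, symmetric] G_def inner_spectral_sums[OF B] by simp
    moreover have "t * (G \<bullet> spectral_sum C (\<lambda>c. if c \<in> K then 1 else 0)) \<le>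
        t * ((real ?n - real k) * (1 / (t + \<alpha>)))"
    proof -
      have "c \<bullet> (G *v c) \<le> 1 / (t + \<alpha>)" if "c \<in> K" for c
      proof -
        have "c \<bullet> (G *v c) \<le> (\<Sum>b\<in>B. 1 / (t + \<alpha>) * (b \<bullet> c)\<^sup>2)"
          unfolding G_def spectral_sum_quadratic using h ta
          by (intro sum_mono mult_right_mono) (auto simp: frac_le)
        also have "\<dots> = 1 / (t + \<alpha>) * (c \<bullet> c)"
          by (simp only: sum_distrib_left[symmetric] onb_parseval[OF B])
        also have "c \<bullet> c = 1" using that K(1) onb_inner[OF C, of c c] by auto
        finally show ?thesis by simp
      qed
      then have "(\<Sum>c\<in>K. c \<bullet> (G *v c)) \<le> card K * (1 / (t + \<alpha>))"
        by (intro sum_bounded_above) auto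
      moreover have "G \<bullet> spectral_sum C (\<lambda>c. if c \<in> K then 1 else 0) = (\<Sum>c\<in>K. c \<bullet> (G *v c))"
        using finC by (simp add: inner_spectral_sum if_distrib if_distribR sum.If_cases CK cong: if_cong)
      ultimately show ?thesis using t by (intro mult_left_mono) (simp_all add: cardK)
    qed
    moreover have "t * ((real ?n - real k) * (1 / (t + \<alpha>))) = (real ?n - real k) * (t / (t + \<alpha>))"
      by simp
    ultimately show ?thesis by linarith
  qed
  moreover have "(\<Sum>b\<in>B. \<alpha> / h b) - ?n + (real ?n - real k) * (t / (t + \<alpha>)) = - (G \<bullet> spectral_sum B \<theta>)"
  proof -
    have "\<alpha> / h b + \<theta> b / h b - 1 = (min (\<theta> b) t - t) / (t + \<alpha>)" for b
    proof (cases "t \<le> \<theta> b")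
      case True
      then show ?thesis using h[of b] by (simp add: h_def add_divide_distrib[symmetric])
    next
      case False
      then have "h b = t + \<alpha>" "min (\<theta> b) t = \<theta> b" by (auto simp: h_def)
      moreover have "(d - t) / d + x / d - 1 = (x - t) / d" if "0 < d" for d x
        using that by (simp add: field_simps)
      from this[OF ta, of "\<theta> b"] have "\<alpha> / (t + \<alpha>) + \<theta> b / (t + \<alpha>) - 1 = (\<theta> b - t) / (t + \<alpha>)"
        by (simp only: add_diff_cancel_left')
      ultimately show ?thesis by (simp only:)
    qed
    then have "(\<Sum>b\<in>B. \<alpha> / h b + \<theta> b / h b - 1) = (\<Sum>b\<in>B. (min (\<theta> b) t - t) / (t + \<alpha>))"
      by simp
    also have "\<dots> = (k * t - ?n * t) / (t + \<alpha>)"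
      by (simp add: sum_divide_distrib[symmetric] sum_subtractf cap onb_card[OF B])
    finally have "(\<Sum>b\<in>B. \<alpha> / h b) + (\<Sum>b\<in>B. \<theta> b / h b) - ?n = (k * t - ?n * t) / (t + \<alpha>)"
      by (simp add: sum.distrib sum_subtractf onb_card[OF B])
    moreover have "G \<bullet> spectral_sum B \<theta> = (\<Sum>b\<in>B. \<theta> b / h b)"
      by (simp add: G_def inner_spectral_sums[OF B])
    ultimately show ?thesis by (simp add: diff_divide_distrib left_diff_distrib)
  qed
  ultimately have "z \<le> (\<Sum>b\<in>B. ln (h b)) - (real ?n - real k) * (ln (t + \<alpha>) - ln \<alpha>) + G \<bullet> (Z - spectral_sum B \<theta>)"
    using zZ by (simp add: inner_diff_right)
  then show ?thesis by (simp add: cap_value_def G_def h_def)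
qed

lemma kl_domain_antimono: "z \<le> z' \<Longrightarrow> kl_domain k \<alpha> z' \<subseteq> kl_domain k \<alpha> z"
  by (auto simp: kl_domain_def)

text \<open>
For \<open>t = 0\<close> the matrix itself has rank at most \<open>k\<close>. Otherwise, with \<open>p\<close> eigenvalues at or above the
cap, the eigenvalues below \<open>t\<close>, divided by \<open>t\<close>, form a point of the hypersimplex. Each of its 0-1 vertices
yields a matrix that keeps those \<open>p\<close> eigenvalues and has \<open>k - p\<close> further eigenvalues \<open>t\<close>,
and all these matrices have the required log-determinant.
\<close>

lemma cap_value_attained:
  fixes B :: "(real^'n) set" and \<theta> :: "real^'n \<Rightarrow> real" and t \<alpha> :: real
  assumes B: "orthonormal_basis B" and \<theta>: "\<And>b. 0 \<le> \<theta> b" and t: "0 \<le> t" and \<alpha>: "0 < \<alpha>"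
    and k: "k \<le> CARD('n)" and cap: "(\<Sum>b\<in>B. min (\<theta> b) t) = k * t"
    and t0: "t = 0 \<Longrightarrow> card {b\<in>B. \<theta> b \<noteq> 0} \<le> k"
  shows "spectral_sum B \<theta> \<in> convex hull (kl_domain k \<alpha> (cap_value k \<alpha> B \<theta> t))"
proof (cases "t = 0")
  case True
  then show ?thesis
    using t0 \<theta> psd_spectral_sum[of B \<theta>]
    by (intro hull_inc) (auto simp: kl_domain_def cap_value_def rank_spectral_sum[OF B]
        logdet_shifted_spectral_sum[OF B _ \<alpha>] max_absorb1)
next
  case False
  with t have t: "0 < t" by simp
  have finB: "finite B" using B by (rule onb_finite)
  define L where "L = {b\<in>B. t \<le> \<theta> b}"
  define J where "J = {b\<in>B. \<theta> b < t}"
  have LJ: "B = L \<union> J" "L \<inter> J = {}" and fin: "finite L" "finite J"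
    using finB by (auto simp: L_def J_def)
  have "(\<Sum>b\<in>B. min (\<theta> b) t) = card L * t + (\<Sum>b\<in>J. \<theta> b)"
    unfolding LJ(1) sum.union_disjoint[OF fin LJ(2)] by (simp add: L_def J_def)
  with cap have eq: "card L * t + (\<Sum>b\<in>J. \<theta> b) = k * t" by simp
  moreover have "0 \<le> (\<Sum>b\<in>J. \<theta> b)" using \<theta> by (simp add: sum_nonneg)
  ultimately have "real (card L) * t \<le> k * t" by simp
  then have Lk: "card L \<le> k" using t by simp
  have "(\<Sum>b\<in>J. \<theta> b / t) = real (k - card L)"
  proof -
    have "(\<Sum>b\<in>J. \<theta> b) = (real k - real (card L)) * t" using eq by (simp add: left_diff_distrib)
    then show ?thesis
      using t Lk by (simp add: sum_divide_distrib[symmetric] of_nat_diff)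
  qed
  from fin(2) _ this have "(\<Sum>b\<in>J. (\<theta> b / t) *\<^sub>R (t *\<^sub>R outer b b)) \<in>
      convex hull {\<Sum>b\<in>T. t *\<^sub>R outer b b | T. T \<subseteq> J \<and> card T = k - card L}"
    by (rule hypersimplex_convex_hull) (use \<theta> t in \<open>simp add: J_def\<close>)
  moreover have "(\<Sum>b\<in>J. (\<theta> b / t) *\<^sub>R (t *\<^sub>R outer b b)) = spectral_sum J \<theta>"
    using t by (simp add: spectral_sum_def)
  ultimately have "spectral_sum L \<theta> + spectral_sum J \<theta> \<in> convex hull
     ((+) (spectral_sum L \<theta>) ` {\<Sum>b\<in>T. t *\<^sub>R outer b b | T. T \<subseteq> J \<and> card T = k - card L})"
    unfolding convex_hull_translation by (intro imageI) simp
  moreover have "spectral_sum L \<theta> + spectral_sum J \<theta> = spectral_sum B \<theta>"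
    unfolding spectral_sum_def LJ(1) sum.union_disjoint[OF fin LJ(2)] ..
  moreover have sub: "(+) (spectral_sum L \<theta>) ` {\<Sum>b\<in>T. t *\<^sub>R outer b b | T. T \<subseteq> J \<and> card T = k - card L}
      \<subseteq> kl_domain k \<alpha> (cap_value k \<alpha> B \<theta> t)"
  proof clarify
    fix T assume T: "T \<subseteq> J" "card T = k - card L"
    define \<eta> where "\<eta> b = (if b \<in> L then \<theta> b else if b \<in> T then t else 0)" for b
    have \<eta>0: "0 \<le> \<eta> b" for b using \<theta> t by (simp add: \<eta>_def)
    have finT: "finite T" using T fin by (auto dest: finite_subset)
    have "spectral_sum B \<eta> = spectral_sum L \<eta> + spectral_sum J \<eta>"
      unfolding spectral_sum_def LJ(1) sum.union_disjoint[OF fin LJ(2)] ..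
    also have "spectral_sum L \<eta> = spectral_sum L \<theta>"
      by (rule spectral_sum_cong) (simp add: \<eta>_def)
    also have "spectral_sum J \<eta> = (\<Sum>b\<in>J. if b \<in> T then t *\<^sub>R outer b b else 0)"
      unfolding spectral_sum_def by (rule sum.cong) (use LJ in \<open>auto simp: \<eta>_def\<close>)
    also have "\<dots> = (\<Sum>b\<in>T. t *\<^sub>R outer b b)"
      using T(1) fin by (simp add: sum.If_cases Int_absorb1)
    finally have eq: "spectral_sum L \<theta> + (\<Sum>b\<in>T. t *\<^sub>R outer b b) = spectral_sum B \<eta>" ..
    have "card {b\<in>B. \<eta> b \<noteq> 0} \<le> card (L \<union> T)"
      using fin finT by (intro card_mono) (auto simp: \<eta>_def)
    also have "\<dots> \<le> card L + card T" by (rule card_Un_le)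
    finally have rk: "card {b\<in>B. \<eta> b \<noteq> 0} \<le> k" using T(2) Lk by simp
    have "card (J - T) = card J - card T" using T(1) finT by (rule card_Diff_subset[rotated])
    moreover have "card J + card L = CARD('n)"
      using LJ fin onb_card[OF B] by (simp add: card_Un_disjoint)
    moreover have "card T \<le> card J" using T(1) fin by (simp add: card_mono)
    ultimately have cJT: "real (card (J - T)) = real CARD('n) - real k"
      using T(2) Lk k by (simp add: of_nat_diff)
    define D where "D = J - T"
    have D: "B \<inter> D = D" using LJ by (auto simp: D_def)
    have "(\<Sum>b\<in>B. ln (\<eta> b + \<alpha>)) =
        (\<Sum>b\<in>B. ln (max (\<theta> b) t + \<alpha>) - (if b \<in> D then ln (t + \<alpha>) - ln \<alpha> else 0))"
      using T(1) by (intro sum.cong) (auto simp: \<eta>_def L_def J_def D_def max_def)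
    also have "\<dots> = (\<Sum>b\<in>B. ln (max (\<theta> b) t + \<alpha>)) - real (card D) * (ln (t + \<alpha>) - ln \<alpha>)"
      by (simp only: sum_subtractf sum.If_cases[OF finB] D Collect_mem_eq) (simp only: sum_constant sum.neutral_const diff_zero add_0_right right_diff_distrib mult_zero_right)
    also have "\<dots> = cap_value k \<alpha> B \<theta> t"
      by (simp add: cap_value_def D_def cJT)
    finally show "spectral_sum L \<theta> + (\<Sum>b\<in>T. t *\<^sub>R outer b b) \<in> kl_domain k \<alpha> (cap_value k \<alpha> B \<theta> t)"
      unfolding eq using \<eta>0 rk psd_spectral_sum[of B \<eta>]
      by (simp add: kl_domain_def rank_spectral_sum[OF B] logdet_shifted_spectral_sum[OF B _ \<alpha>])
  qed
  ultimately show ?thesis using hull_mono[OF sub, of convex] by (simp only: subsetD)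
qed

text \<open>
If more than \<open>k\<close> eigenvalues are nonzero, the concave function \<open>\<Sum> min(\<theta>\<^sub>b, t) - k t\<close> is nonnegative at
the smallest nonzero eigenvalue and eventually negative, so it has a positive zero. Otherwise the
cap \<open>0\<close> serves.
\<close>

lemma cap_exists:
  fixes B :: "'a set" and \<theta> :: "'a \<Rightarrow> real"
  assumes fin: "finite B" and \<theta>: "\<And>b. 0 \<le> \<theta> b" and k: "1 \<le> k"
  shows "\<exists>t\<ge>0. (\<Sum>b\<in>B. min (\<theta> b) t) = real k * t \<and>
    (t = 0 \<longrightarrow> card {b\<in>B. \<theta> b \<noteq> 0} \<le> k)"
proof (cases "card {b\<in>B. \<theta> b \<noteq> 0} \<le> k")
  case True
  show ?thesis
    by (rule exI[of _ 0]) (use True \<theta> in \<open>auto simp: min_absorb2\<close>)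
next
  case False
  let ?S = "{b\<in>B. \<theta> b \<noteq> 0}"
  define t0 where "t0 = Min (\<theta> ` ?S)"
  define t1 where "t1 = t0 + (\<Sum>b\<in>B. \<theta> b)"
  have S: "?S \<noteq> {}" "finite ?S" using False fin by (metis card.empty le0, simp)
  have t0: "0 < t0" "\<And>b. b \<in> ?S \<Longrightarrow> t0 \<le> \<theta> b"
  proof -
    have "t0 \<in> \<theta> ` ?S" unfolding t0_def using S by (intro Min_in) auto
    then show "0 < t0" using \<theta> by (auto simp: less_le)
    show "t0 \<le> \<theta> b" if "b \<in> ?S" for b
      unfolding t0_def using S that by (intro Min_le) auto
  qed
  have sum0: "0 \<le> (\<Sum>b\<in>B. \<theta> b)" using \<theta> by (simp add: sum_nonneg)
  let ?f = "\<lambda>t::real. (\<Sum>b\<in>B. min (\<theta> b) t) - real k * t"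
  have "(\<Sum>b\<in>?S. t0) \<le> (\<Sum>b\<in>?S. min (\<theta> b) t0)"
    using t0 by (intro sum_mono) auto
  also have "\<dots> \<le> (\<Sum>b\<in>B. min (\<theta> b) t0)"
    using fin \<theta> t0 by (intro sum_mono2) auto
  finally have "card ?S * t0 \<le> (\<Sum>b\<in>B. min (\<theta> b) t0)" by simp
  moreover have "k * t0 \<le> card ?S * t0" using False t0 by simp
  ultimately have f0: "0 \<le> ?f t0" by simp
  have "(\<Sum>b\<in>B. min (\<theta> b) t1) \<le> (\<Sum>b\<in>B. \<theta> b)" by (intro sum_mono) simp
  also have "\<dots> \<le> 1 * t1" using t0 by (simp add: t1_def)
  also have "\<dots> \<le> k * t1" using k t0 sum0 by (intro mult_right_mono) (auto simp: t1_def)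
  finally have f1: "?f t1 \<le> 0" by simp
  have "\<exists>t\<ge>t0. t \<le> t1 \<and> ?f t = 0"
    by (rule IVT2'[where f = ?f and y = 0, OF f1 f0]) (use sum0 in \<open>auto simp: t1_def intro!: continuous_intros\<close>)
  then obtain t where "t0 \<le> t" "?f t = 0" by blast
  then show ?thesis using t0 by (intro exI[of _ t]) auto
qed

section \<open>The hypograph of the level function\<close>

lemma psd_add: "psd X \<Longrightarrow> psd Z \<Longrightarrow> psd (X + Z)"
  for X Z :: "real^'n^'n"
  by (simp add: psd_def transpose_add matrix_vector_mult_add_rdistrib inner_add_right)

lemma psd_scaleR: "psd X \<Longrightarrow> 0 \<le> c \<Longrightarrow> psd (c *\<^sub>R X)"
  for X :: "real^'n^'n"
  by (simp add: psd_def transpose_scaleR scaleR_matrix_vector_assoc[symmetric])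

lemma convex_psd: "convex {X :: real^'n^'n. psd X}"
  by (rule convexI) (simp add: psd_add psd_scaleR)

text \<open>
The condition is an intersection of conditions that are linear in the matrix, one for each entry and
one for each vector.
\<close>

lemma closed_psd: "closed {X :: real^'n^'n. psd X}"
proof -
  have "{X :: real^'n^'n. psd X} =
      (\<Inter>i. \<Inter>j. {X. X $ i $ j = X $ j $ i}) \<inter> (\<Inter>v. {X. 0 \<le> X \<bullet> outer v v})"
    by (auto simp: psd_def transpose_def vec_eq_iff inner_outer)
  moreover have "closed \<dots>"
    by (intro closed_Int closed_INT ballI closed_Collect_eq closed_Collect_le continuous_intros)
  ultimately show ?thesis by simp
qed

lemma hull_kl_domain_psd:
  assumes "X \<in> convex hull (kl_domain k \<alpha> z)"
  shows "psd X"
proof -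
  have "convex hull (kl_domain k \<alpha> z) \<subseteq> {X. psd X}"
    by (rule hull_minimal) (auto simp: kl_domain_def convex_psd)
  with assms show ?thesis by blast
qed

text \<open>
The bound is affine in \<open>Z\<close>, hence passes from the generators to their convex hull.
\<close>

lemma cap_value_supports_hull:
  fixes B :: "(real^'n) set" and \<theta> :: "real^'n \<Rightarrow> real" and t \<alpha> :: real
  assumes B: "orthonormal_basis B" and \<theta>: "\<And>b. 0 \<le> \<theta> b" and t: "0 \<le> t" and \<alpha>: "0 < \<alpha>"
    and k: "k \<le> CARD('n)" and cap: "(\<Sum>b\<in>B. min (\<theta> b) t) = k * t"
    and Z: "Z \<in> convex hull (kl_domain k \<alpha> z)"
  shows "z \<le> cap_value k \<alpha> B \<theta> t +
    spectral_sum B (\<lambda>b. 1 / (max (\<theta> b) t + \<alpha>)) \<bullet> (Z - spectral_sum B \<theta>)"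
proof -
  let ?c = "cap_value k \<alpha> B \<theta> t" and ?G = "spectral_sum B (\<lambda>b. 1 / (max (\<theta> b) t + \<alpha>))"
  have "convex {Z. ?G \<bullet> Z \<ge> z - ?c + ?G \<bullet> spectral_sum B \<theta>}"
    by (rule convex_halfspace_ge)
  then have "convex hull (kl_domain k \<alpha> z) \<subseteq> {Z. ?G \<bullet> Z \<ge> z - ?c + ?G \<bullet> spectral_sum B \<theta>}"
    using cap_value_supports[OF B \<theta> t \<alpha> k cap]
    by (intro hull_minimal) (auto simp: inner_diff_right algebra_simps)
  with Z show ?thesis by (auto simp: inner_diff_right algebra_simps)
qed

text \<open>
The two bounds combined: the level function has an attained value and a supergradient at every
positive semidefinite matrix. Convexity and closedness of its hypograph follow.
\<close>

lemma hull_kl_domain_support: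
  fixes X :: "real^'n^'n"
  assumes X: "psd X" and k: "1 \<le> k" "k \<le> CARD('n)" and \<alpha>: "0 < \<alpha>"
  shows "\<exists>\<phi> G. X \<in> convex hull (kl_domain k \<alpha> \<phi>) \<and>
    (\<forall>z. \<forall>Z \<in> convex hull (kl_domain k \<alpha> z). z \<le> \<phi> + G \<bullet> (Z - X))"
proof (rule psd_spectral_decomposition[OF X])
  fix B \<theta> assume B: "orthonormal_basis B" and \<theta>: "\<And>b. 0 \<le> \<theta> b" and XB: "X = spectral_sum B \<theta>"
  from cap_exists[of B \<theta> k, OF onb_finite[OF B] \<theta> k(1)]
  obtain t where t: "0 \<le> t" "(\<Sum>b\<in>B. min (\<theta> b) t) = real k * t"
    "t = 0 \<longrightarrow> card {b\<in>B. \<theta> b \<noteq> 0} \<le> k"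
    by (elim exE conjE)
  show ?thesis
    unfolding XB
  proof (rule exI[of _ "cap_value k \<alpha> B \<theta> t"],
      rule exI[of _ "spectral_sum B (\<lambda>b. 1 / (max (\<theta> b) t + \<alpha>))"], intro conjI allI ballI)
    show "spectral_sum B \<theta> \<in> convex hull (kl_domain k \<alpha> (cap_value k \<alpha> B \<theta> t))"
      by (rule cap_value_attained[OF B \<theta> t(1) \<alpha> k(2) t(2) t(3)[rule_format]])
  qed (rule cap_value_supports_hull[OF B \<theta> t(1) \<alpha> k(2) t(2)])
qed

lemma hull_kl_domain_antimono:
  "z \<le> z' \<Longrightarrow> X \<in> convex hull (kl_domain k \<alpha> z') \<Longrightarrow> X \<in> convex hull (kl_domain k \<alpha> z)"
  using hull_mono[OF kl_domain_antimono, of z z' convex k \<alpha>] by (rule subsetD)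

definition hull_hypograph :: "nat \<Rightarrow> real \<Rightarrow> (real \<times> (real^'n^'n)) set" where
  "hull_hypograph k \<alpha> = {(z, X). X \<in> convex hull (kl_domain k \<alpha> z)}"

lemma convex_hull_hypograph:
  assumes k: "1 \<le> k" "k \<le> CARD('n)" and \<alpha>: "0 < \<alpha>"
  shows "convex (hull_hypograph k \<alpha> :: (real \<times> (real^'n^'n)) set)"
proof (rule convexI, clarsimp simp: hull_hypograph_def)
  fix z1 z2 u v :: real and X1 X2 :: "real^'n^'n"
  assume 1: "X1 \<in> convex hull (kl_domain k \<alpha> z1)" and 2: "X2 \<in> convex hull (kl_domain k \<alpha> z2)"
    and uv: "0 \<le> u" "0 \<le> v" "u + v = 1"
  define X where "X = u *\<^sub>R X1 + v *\<^sub>R X2"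
  have "psd X" unfolding X_def
    using 1 2 uv by (intro psd_add psd_scaleR hull_kl_domain_psd)
  from hull_kl_domain_support[OF this k \<alpha>]
  obtain \<phi> G where \<phi>: "X \<in> convex hull (kl_domain k \<alpha> \<phi>)"
    "\<forall>z. \<forall>Z \<in> convex hull (kl_domain k \<alpha> z). z \<le> \<phi> + G \<bullet> (Z - X)"
    by (elim exE conjE)
  have "u * z1 + v * z2 \<le> u * (\<phi> + G \<bullet> (X1 - X)) + v * (\<phi> + G \<bullet> (X2 - X))"
    using uv \<phi>(2)[rule_format, OF 1] \<phi>(2)[rule_format, OF 2] by (intro add_mono mult_left_mono)
  also have "\<dots> = (u + v) * (\<phi> - G \<bullet> X) + G \<bullet> X"
    by (simp add: X_def inner_diff_right inner_add_right algebra_simps)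
  also have "\<dots> = \<phi>" by (simp add: uv)
  finally show "u *\<^sub>R X1 + v *\<^sub>R X2 \<in> convex hull (kl_domain k \<alpha> (u * z1 + v * z2))"
    using hull_kl_domain_antimono[OF _ \<phi>(1)] by (simp add: X_def)
qed

lemma closed_hull_hypograph:
  assumes k: "1 \<le> k" "k \<le> CARD('n)" and \<alpha>: "0 < \<alpha>"
  shows "closed (hull_hypograph k \<alpha> :: (real \<times> (real^'n^'n)) set)"
  unfolding closed_sequential_limits
proof (intro allI impI, elim conjE)
  fix p :: "nat \<Rightarrow> real \<times> (real^'n^'n)" and l
  assume p: "\<forall>n. p n \<in> hull_hypograph k \<alpha>" and lim: "p \<longlonglongrightarrow> l"
  obtain z X where l: "l = (z, X)" by (cases l)
  have lz: "(\<lambda>n. fst (p n)) \<longlonglongrightarrow> z" and lX: "(\<lambda>n. snd (p n)) \<longlonglongrightarrow> X"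
    using tendsto_fst[OF lim] tendsto_snd[OF lim] by (simp_all add: l)
  have mem: "snd (p n) \<in> convex hull (kl_domain k \<alpha> (fst (p n)))" for n
    using p by (auto simp: hull_hypograph_def case_prod_beta)
  have "psd X"
    using closed_sequentially[OF closed_psd _ lX] hull_kl_domain_psd[OF mem] by simp
  from hull_kl_domain_support[OF this k \<alpha>]
  obtain \<phi> G where \<phi>: "X \<in> convex hull (kl_domain k \<alpha> \<phi>)"
    "\<forall>z. \<forall>Z \<in> convex hull (kl_domain k \<alpha> z). z \<le> \<phi> + G \<bullet> (Z - X)"
    by (elim exE conjE)
  have "(\<lambda>n. \<phi> + G \<bullet> (snd (p n) - X)) \<longlonglongrightarrow> \<phi> + G \<bullet> (X - X)"
    by (intro tendsto_intros lX)
  from LIMSEQ_le[OF lz this] have "z \<le> \<phi> + G \<bullet> (X - X)"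
    using \<phi>(2)[rule_format, OF mem] by blast
  then show "l \<in> hull_hypograph k \<alpha>"
    using hull_kl_domain_antimono[OF _ \<phi>(1)] by (simp add: l hull_hypograph_def)
qed

section \<open>Perturbations of the eigenvalues below the cap\<close>

lemma exists_orthogonal_in_subspace:
  fixes W T :: "'a::euclidean_space set"
  assumes W: "subspace W" and dim: "dim T < dim W"
  obtains x where "x \<in> W" "x \<noteq> 0" "\<And>a. a \<in> T \<Longrightarrow> a \<bullet> x = 0"
proof -
  define P where "P = {y \<in> UNIV. \<forall>x \<in> span T. orthogonal x y}"
  have P: "subspace P"
    by (auto simp: P_def subspace_def orthogonal_def inner_add_right)
  have "dim P + dim T = DIM('a)"
    using dim_subspace_orthogonal_to_vectors[of "span T" UNIV] by (simp add: P_def)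
  moreover have "dim {x + y |x y. x \<in> W \<and> y \<in> P} + dim (W \<inter> P) = dim W + dim P"
    by (rule dim_sums_Int[OF W P])
  moreover have "dim {x + y |x y. x \<in> W \<and> y \<in> P} \<le> DIM('a)"
    by (rule dim_subset_UNIV)
  ultimately have "dim (W \<inter> P) \<noteq> 0" using dim by linarith
  then obtain x where "x \<in> W" "x \<in> P" "x \<noteq> 0" by auto
  then show ?thesis using that[of x] by (auto simp: P_def orthogonal_def span_base)
qed

text \<open>
The symmetrized products of unordered pairs from \<open>M\<close> are pairwise orthogonal for the Frobenius inner
product.
\<close>

lemma dim_symmetric_outer_products:
  fixes M :: "(real^'n) set"
  assumes fin: "finite M" and on: "\<forall>b\<in>M. \<forall>c\<in>M. b \<bullet> c = (if b = c then 1 else 0)"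
  shows "card M * (card M + 1) \<le> 2 * dim (span {outer a b + outer b a | a b. a \<in> M \<and> b \<in> M})"
proof -
  let ?S = "{outer a b + outer b a | a b. a \<in> M \<and> b \<in> M}"
  define q where "q = card M"
  obtain f where f: "bij_betw f {..<q} M"
    using ex_bij_betw_nat_finite[OF fin] by (auto simp: q_def lessThan_atLeast0)
  have ff: "f i \<bullet> f j = (if i = j then 1 else 0)" if "i < q" "j < q" for i j
    using f on that by (auto simp: bij_betw_def inj_on_def)
  \<comment> \<open>Each unordered pair of elements of \<open>M\<close> is represented once, with the larger index first.\<close>
  define P where "P = (SIGMA j:{..<q}. {..j})"
  define e where "e = (\<lambda>(j, i). outer (f i) (f j) + outer (f j) (f i))"
  have ee: "e x \<bullet> e y = (if x = y then if fst x = snd x then 4 else 2 else 0)" if "x \<in> P" "y \<in> P" for x y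
  proof -
    have "e (j, i) \<bullet> e (l, m) = 2 * ((if i = m then 1 else 0) * (if j = l then 1 else 0) +
        (if i = l then 1 else 0) * (if j = m then 1 else 0))"
      if "i < q" "j < q" "l < q" "m < q" for i j l m
      using that by (simp add: e_def inner_add_left inner_add_right inner_outer_outer ff)
    then show ?thesis using that by (auto simp: P_def split: if_splits)
  qed
  have inj: "inj_on e P"
  proof (rule inj_onI, rule ccontr)
    fix x y assume "x \<in> P" "y \<in> P" "e x = e y" "x \<noteq> y"
    then show False using ee[of x x] ee[of x y] by (simp split: if_splits)
  qed
  have "pairwise orthogonal (e ` P)"
    unfolding pairwise_image by (rule pairwiseI) (simp add: orthogonal_def ee)
  moreover have "0 \<notin> e ` P"
  proof
    assume "0 \<in> e ` P"
    then obtain x where "x \<in> P" "e x = 0" by auto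
    then show False using ee[of x x] by (simp split: if_splits)
  qed
  ultimately have "independent (e ` P)" by (rule pairwise_orthogonal_independent)
  moreover have "e ` P \<subseteq> span ?S"
    using f by (intro subset_trans[OF _ span_superset]) (force simp: P_def e_def bij_betw_def)
  ultimately have "card (e ` P) \<le> dim (span ?S)"
    by (intro independent_card_le_dim)
  moreover have "2 * card P = q * (q + 1)"
  proof -
    have "card P = (\<Sum>j<q. Suc j)" by (simp add: P_def)
    moreover have "2 * (\<Sum>j<q. Suc j) = q * (q + 1)" by (induction q) auto
    ultimately show ?thesis by simp
  qed
  ultimately show ?thesis using card_image[OF inj] by (simp add: q_def)
qed

text \<open>
The symmetric matrix \<open>\<Delta>\<close> acts on the span of the eigenvectors with eigenvalues strictly between \<open>0\<close> and
\<open>t\<close>. A small multiple of it keeps the eigenvalues of this block between \<open>0\<close> and \<open>t\<close>, and since it is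
traceless it keeps their sum. Diagonalizing the perturbed block and keeping the other eigenvectors
shows that the perturbed matrix satisfies the same cap equation with the same \<open>t\<close> and has the same
\<open>cap_value\<close>.
\<close>

lemma block_perturbation:
  fixes B :: "(real^'n) set" and \<theta> :: "real^'n \<Rightarrow> real" and t \<alpha> :: real and \<Delta> :: "real^'n^'n"
  assumes B: "orthonormal_basis B" and \<theta>: "\<And>b. 0 \<le> \<theta> b" and t: "0 < t" and \<alpha>: "0 < \<alpha>"
    and k: "k \<le> CARD('n)" and cap: "(\<Sum>b\<in>B. min (\<theta> b) t) = k * t"
    and M: "M = {b\<in>B. 0 < \<theta> b \<and> \<theta> b < t}"
    and \<Delta>: "transpose \<Delta> = \<Delta>" "\<And>v. \<Delta> *v v \<in> span M" "mat 1 \<bullet> \<Delta> = 0"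
  shows "\<exists>\<delta>>0. \<forall>\<epsilon>. \<bar>\<epsilon>\<bar> \<le> \<delta> \<longrightarrow>
    spectral_sum B \<theta> + \<epsilon> *\<^sub>R \<Delta> \<in> convex hull (kl_domain k \<alpha> (cap_value k \<alpha> B \<theta> t))"
proof -
  let ?V = "span M"
  have finB: "finite B" using B by (rule onb_finite)
  have MB: "M \<subseteq> B" and finM: "finite M" using finB by (auto simp: M)
  \<comment> \<open>The distance of the eigenvalues of the block from \<open>0\<close> and \<open>t\<close>; the element \<open>1\<close> keeps the set
    nonempty when the block is empty.\<close>
  define \<delta>0 where "\<delta>0 = Min (insert 1 ((\<lambda>b. min (\<theta> b) (t - \<theta> b)) ` M))"
  have \<delta>0: "0 < \<delta>0" "\<And>b. b \<in> M \<Longrightarrow> \<delta>0 \<le> \<theta> b \<and> \<theta> b + \<delta>0 \<le> t"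
  proof -
    show "0 < \<delta>0" using finM by (auto simp: \<delta>0_def M)
    fix b assume "b \<in> M"
    then have "\<delta>0 \<le> min (\<theta> b) (t - \<theta> b)" unfolding \<delta>0_def using finM by (intro Min_le) auto
    then show "\<delta>0 \<le> \<theta> b \<and> \<theta> b + \<delta>0 \<le> t" by auto
  qed
  have orthV: "b \<bullet> v = 0" if "b \<in> B - M" "v \<in> ?V" for b v
  proof -
    have "orthogonal b v"
      using that(2)
      by (rule orthogonal_to_span) (use that(1) MB onb_inner[OF B] in \<open>auto simp: orthogonal_def\<close>)
    then show ?thesis by (simp add: orthogonal_def)
  qed
  have \<Delta>0: "\<Delta> *v b = 0" if "b \<in> B - M" for b
  proof -
    have "(\<Delta> *v b) \<bullet> (\<Delta> *v b) = b \<bullet> (\<Delta> *v (\<Delta> *v b))"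
      by (rule symmetric_inner[OF \<Delta>(1)])
    then show ?thesis using orthV[OF that \<Delta>(2)] by simp
  qed
  let ?X = "spectral_sum B \<theta>"
  have "subspace {v. ?X *v v \<in> ?V}"
    by (auto simp: subspace_def matrix_vector_right_distrib matrix_vector_mult_scaleR
        span_add span_scale span_zero)
  moreover have "M \<subseteq> {v. ?X *v v \<in> ?V}"
    using MB onb_eigenvectors[OF B, of _ \<theta>] by (auto simp: span_base span_scale)
  ultimately have XV: "?X *v v \<in> ?V" if "v \<in> ?V" for v
    using that span_minimal by blast
  have "?X + \<epsilon> *\<^sub>R \<Delta> \<in> convex hull (kl_domain k \<alpha> (cap_value k \<alpha> B \<theta> t))"
    if \<epsilon>: "\<bar>\<epsilon>\<bar> \<le> \<delta>0 / (norm \<Delta> + 1)" for \<epsilon>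
  proof -
    define Z where "Z = ?X + \<epsilon> *\<^sub>R \<Delta>"
    have Zv: "Z *v v = ?X *v v + \<epsilon> *\<^sub>R (\<Delta> *v v)" for v
      by (simp add: Z_def matrix_vector_mult_add_rdistrib scaleR_matrix_vector_assoc)
    have "\<bar>\<epsilon>\<bar> * norm \<Delta> \<le> \<delta>0 / (norm \<Delta> + 1) * (norm \<Delta> + 1)"
      using \<epsilon> \<delta>0(1) by (intro mult_mono) auto
    then have \<epsilon>\<Delta>: "\<bar>\<epsilon>\<bar> * norm \<Delta> \<le> \<delta>0"
      by (simp add: add_nonneg_eq_0_iff)
    have symX: "transpose ?X = ?X" using psd_spectral_sum[of B \<theta>] \<theta> by (simp add: psd_def)
    have symZ: "transpose Z = Z" by (simp add: Z_def transpose_add transpose_scaleR symX \<Delta>(1))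
    have ZV: "Z *v v \<in> ?V" if "v \<in> ?V" for v
      unfolding Zv using XV[OF that] \<Delta>(2)[of v] by (simp add: span_add span_scale)
    obtain C where C: "C \<subseteq> ?V" "span C = ?V" "finite C" "card C = dim ?V"
      "\<forall>b\<in>C. \<forall>c\<in>C. b \<bullet> c = (if b = c then 1 else 0)"
      "\<And>b. b \<in> C \<Longrightarrow> Z *v b = (b \<bullet> (Z *v b)) *\<^sub>R b"
      using spectral_theorem_subspace[OF symZ subspace_span ZV] by metis
    have "independent M" using onb_independent[OF B] MB by (rule independent_mono)
    then have cardC: "card C = card M" using C(4) by (simp add: dim_eq_card_independent)
    have orthC: "b \<bullet> c = 0" "c \<bullet> b = 0" if "b \<in> B - M" "c \<in> C" for b c
      using orthV[OF that(1), of c] that(2) C(1) by (auto simp: inner_commute[of c b])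
    have disj: "(B - M) \<inter> C = {}"
      using orthC C(5) by (metis Int_emptyI zero_neq_one)
    define B' where "B' = (B - M) \<union> C"
    have "span B' = UNIV"
    proof -
      have "M \<subseteq> span B'"
        using C(2) span_mono[of C B'] span_superset[of M] by (auto simp: B'_def)
      then have "B \<subseteq> span B'" using span_superset[of B'] by (auto simp: B'_def)
      then have "span B \<subseteq> span B'" by (simp add: span_minimal)
      then show ?thesis using onb_span[OF B] by auto
    qed
    then have B': "orthonormal_basis B'"
      using onb_inner[OF B] C(5) orthC disj unfolding orthonormal_basis_def B'_def by (auto 0 3)
    define \<eta> where "\<eta> b = (if b \<in> C then b \<bullet> (Z *v b) else \<theta> b)" for b
    have Z': "Z = spectral_sum B' \<eta>"
    proof (rule eq_spectral_sum[OF B'])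
      fix b assume "b \<in> B'"
      then consider "b \<in> B - M" "b \<notin> C" | "b \<in> C" using disj by (auto simp: B'_def)
      then show "Z *v b = \<eta> b *\<^sub>R b"
      proof cases
        case 1
        then show ?thesis using onb_eigenvectors[OF B, of b \<theta>] by (simp add: Zv \<Delta>0 \<eta>_def)
      next
        case 2
        then show ?thesis using C(6)[of b] by (simp add: \<eta>_def)
      qed
    qed
    have \<eta>C: "0 \<le> \<eta> b \<and> \<eta> b \<le> t" if b: "b \<in> C" for b
    proof -
      have bb: "b \<bullet> b = 1" using C(5) b by simp
      have bV: "b \<in> ?V" using C(1) b by auto
      have sumM: "(\<Sum>c\<in>B. g c * (c \<bullet> b)\<^sup>2) = (\<Sum>c\<in>M. g c * (c \<bullet> b)\<^sup>2)" for g :: "real^'n \<Rightarrow> real"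
        using orthV[OF _ bV] MB finB by (intro sum.mono_neutral_right) auto
      have one: "(\<Sum>c\<in>M. (c \<bullet> b)\<^sup>2) = 1"
        using sumM[of "\<lambda>_. 1"] onb_parseval[OF B, of b] bb by simp
      have quad: "b \<bullet> (?X *v b) = (\<Sum>c\<in>M. \<theta> c * (c \<bullet> b)\<^sup>2)"
        by (simp add: spectral_sum_quadratic sumM)
      have "norm (outer b b) = 1"
        using bb by (simp add: norm_eq_sqrt_inner inner_outer_outer)
      then have "\<bar>b \<bullet> (\<Delta> *v b)\<bar> \<le> norm \<Delta>"
        using Cauchy_Schwarz_ineq2[of \<Delta> "outer b b"] by (simp add: inner_outer)
      then have "\<bar>\<epsilon>\<bar> * \<bar>b \<bullet> (\<Delta> *v b)\<bar> \<le> \<bar>\<epsilon>\<bar> * norm \<Delta>"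
        by (rule mult_left_mono) simp
      then have small: "\<bar>\<epsilon> * (b \<bullet> (\<Delta> *v b))\<bar> \<le> \<delta>0" using \<epsilon>\<Delta> by (simp add: abs_mult)
      have "(\<Sum>c\<in>M. \<delta>0 * (c \<bullet> b)\<^sup>2) \<le> (\<Sum>c\<in>M. \<theta> c * (c \<bullet> b)\<^sup>2)"
        using \<delta>0(2) by (intro sum_mono mult_right_mono) auto
      moreover have "(\<Sum>c\<in>M. \<theta> c * (c \<bullet> b)\<^sup>2) \<le> (\<Sum>c\<in>M. (t - \<delta>0) * (c \<bullet> b)\<^sup>2)"
        using \<delta>0(2) by (intro sum_mono mult_right_mono) (auto simp: algebra_simps)
      ultimately have "\<delta>0 \<le> b \<bullet> (?X *v b)" "b \<bullet> (?X *v b) \<le> t - \<delta>0"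
        unfolding quad sum_distrib_left[symmetric] one by simp_all
      then show ?thesis
        using small b by (auto simp: \<eta>_def Zv inner_add_right abs_le_iff)
    qed
    have \<eta>0: "0 \<le> \<eta> b" for b using \<eta>C \<theta> by (cases "b \<in> C") (auto simp: \<eta>_def)
    have split': "(\<Sum>b\<in>B'. g b) = (\<Sum>b\<in>B - M. g b) + (\<Sum>b\<in>C. g b)" for g :: "real^'n \<Rightarrow> real"
      unfolding B'_def using finB C(3) disj by (intro sum.union_disjoint) auto
    have split: "(\<Sum>b\<in>B. g b) = (\<Sum>b\<in>B - M. g b) + (\<Sum>b\<in>M. g b)" for g :: "real^'n \<Rightarrow> real"
      using sum.subset_diff[OF MB finB] .
    have \<eta>BM: "\<eta> b = \<theta> b" if "b \<in> B - M" for b using that disj by (auto simp: \<eta>_def)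
    have trace: "(\<Sum>b\<in>C. \<eta> b) = (\<Sum>b\<in>M. \<theta> b)"
    proof -
      have "(\<Sum>b\<in>B'. \<eta> b) = mat 1 \<bullet> Z"
        using inner_spectral_sums[OF B', of "\<lambda>_. 1" \<eta>] spectral_sum_const[OF B', of 1] by (simp add: Z')
      also have "\<dots> = mat 1 \<bullet> ?X" by (simp add: Z_def inner_add_right \<Delta>(3))
      also have "\<dots> = (\<Sum>b\<in>B. \<theta> b)"
        using inner_spectral_sums[OF B, of "\<lambda>_. 1" \<theta>] spectral_sum_const[OF B, of 1] by simp
      finally show ?thesis by (simp add: split split' \<eta>BM)
    qed
    have "(\<Sum>b\<in>C. min (\<eta> b) t) = (\<Sum>b\<in>C. \<eta> b)" using \<eta>C by (intro sum.cong) auto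
    moreover have "(\<Sum>b\<in>M. min (\<theta> b) t) = (\<Sum>b\<in>M. \<theta> b)" by (intro sum.cong) (auto simp: M)
    ultimately have cap': "(\<Sum>b\<in>B'. min (\<eta> b) t) = k * t"
      using cap trace by (simp add: split split' \<eta>BM)
    have "(\<Sum>b\<in>C. ln (max (\<eta> b) t + \<alpha>)) = (\<Sum>b\<in>C. ln (t + \<alpha>))"
      using \<eta>C by (intro sum.cong) (auto simp: max_absorb2)
    moreover have "(\<Sum>b\<in>M. ln (max (\<theta> b) t + \<alpha>)) = (\<Sum>b\<in>M. ln (t + \<alpha>))"
      by (intro sum.cong) (auto simp: M)
    ultimately have "cap_value k \<alpha> B' \<eta> t = cap_value k \<alpha> B \<theta> t"
      unfolding cap_value_def split split' by (simp add: \<eta>BM cardC)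
    then show ?thesis
      using cap_value_attained[OF B' \<eta>0 less_imp_le[OF t] \<alpha> k cap'] t
      unfolding Z_def[symmetric] Z' by simp
  qed
  moreover have "0 < \<delta>0 / (norm \<Delta> + 1)" using \<delta>0(1) by (simp add: add_nonneg_pos)
  ultimately show ?thesis by blast
qed

section \<open>Rank reduction\<close>

lemma trace_spectral_sum: "orthonormal_basis B \<Longrightarrow> mat 1 \<bullet> spectral_sum B \<theta> = (\<Sum>b\<in>B. \<theta> b)"
  using inner_spectral_sums[of B "\<lambda>_. 1" \<theta>] spectral_sum_const[of B 1] by simp

lemma norm_le_trace:
  fixes X :: "real^'n^'n"
  assumes "psd X"
  shows "norm X \<le> mat 1 \<bullet> X"
proof (rule psd_spectral_decomposition[OF assms])
  fix B \<theta> assume B: "orthonormal_basis B" and \<theta>: "\<And>b. 0 \<le> \<theta> b" and X: "X = spectral_sum B \<theta>"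
  have "X \<bullet> X = (\<Sum>b\<in>B. \<theta> b * \<theta> b)" by (simp add: X inner_spectral_sums[OF B])
  also have "\<dots> \<le> (\<Sum>b\<in>B. \<theta> b * (\<Sum>c\<in>B. \<theta> c))"
    using onb_finite[OF B] \<theta> by (intro sum_mono mult_left_mono member_le_sum) auto
  also have "\<dots> = (mat 1 \<bullet> X)\<^sup>2"
    by (simp add: X trace_spectral_sum[OF B] power2_eq_square sum_distrib_right[symmetric])
  finally have "X \<bullet> X \<le> (mat 1 \<bullet> X)\<^sup>2" .
  moreover have "0 \<le> mat 1 \<bullet> X" by (simp add: X trace_spectral_sum[OF B] sum_nonneg \<theta>)
  ultimately show ?thesis unfolding norm_eq_sqrt_inner by (intro real_le_lsqrt) auto
qed

text \<open>
If the block of eigenvalues strictly between \<open>0\<close> and \<open>t\<close> were empty, the cap equation would make the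
rank equal to \<open>k\<close>. So the block has a positive sum, fewer than \<open>k\<close> eigenvalues reach the cap, and the
other nonzero eigenvalues lie in the block.
\<close>

lemma block_rank:
  fixes B :: "(real^'n) set" and \<theta> :: "real^'n \<Rightarrow> real" and t :: real
  assumes B: "orthonormal_basis B" and \<theta>: "\<And>b. 0 \<le> \<theta> b" and t: "0 < t"
    and cap: "(\<Sum>b\<in>B. min (\<theta> b) t) = k * t" and rank: "k < rank (spectral_sum B \<theta>)"
  shows "rank (spectral_sum B \<theta>) + 1 \<le> k + card {b\<in>B. 0 < \<theta> b \<and> \<theta> b < t}"
proof -
  let ?L = "{b\<in>B. t \<le> \<theta> b}" and ?M = "{b\<in>B. 0 < \<theta> b \<and> \<theta> b < t}" and ?N = "{b\<in>B. \<theta> b = 0}"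
  have fin: "finite B" using B by (rule onb_finite)
  have "{b\<in>B. \<theta> b \<noteq> 0} = ?L \<union> ?M" using \<theta> t by (auto simp: less_le)
  then have r: "rank (spectral_sum B \<theta>) = card ?L + card ?M"
    using fin by (simp add: rank_spectral_sum[OF B]) (subst card_Un_disjoint, auto)
  have "B = (?L \<union> ?M) \<union> ?N" using \<theta> by (auto simp: less_le)
  then have "(\<Sum>b\<in>B. min (\<theta> b) t) = (\<Sum>b\<in>(?L \<union> ?M) \<union> ?N. min (\<theta> b) t)" by simp
  also have "\<dots> = (\<Sum>b\<in>?L. min (\<theta> b) t) + (\<Sum>b\<in>?M. min (\<theta> b) t) + (\<Sum>b\<in>?N. min (\<theta> b) t)"
    using fin t by (subst sum.union_disjoint, auto)+
  also have "(\<Sum>b\<in>?L. min (\<theta> b) t) = (\<Sum>b\<in>?L. t)" by (intro sum.cong) auto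
  also have "(\<Sum>b\<in>?M. min (\<theta> b) t) = (\<Sum>b\<in>?M. \<theta> b)" by (intro sum.cong) auto
  also have "(\<Sum>b\<in>?N. min (\<theta> b) t) = 0" using t by (intro sum.neutral) auto
  finally have eq: "card ?L * t + (\<Sum>b\<in>?M. \<theta> b) = k * t" using cap by simp
  have "?M \<noteq> {}"
  proof
    assume "?M = {}"
    then show False using eq r rank t by (simp only: sum.empty card.empty) simp
  qed
  then have "0 < (\<Sum>b\<in>?M. \<theta> b)" using fin by (intro sum_pos) auto
  then have "card ?L * t < k * t" using eq by linarith
  then have "card ?L < k" using t by simp
  then show ?thesis using r by simp
qed

text \<open>
The level \<open>z\<close>, the trace and the values \<open>\<langle>A, X\<rangle>\<close> are fixed, which leaves a compact convex set; the
witness is an extreme point of the face where \<open>\<langle>C, \<cdot>\<rangle>\<close> is minimal. Fixing the trace costs nothing,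
as only traceless perturbations are used, and it makes the set bounded even if the feasible set is
not. Subtraction of natural numbers is meant to be truncated: rank at most \<open>k\<close> gives \<open>0\<close> on the left
of the last inequality.
\<close>

lemma rank_reduction:
  fixes X0 C :: "real^'n^'n" and \<A> :: "(real^'n^'n) set"
  assumes k: "1 \<le> k" "k \<le> CARD('n)" and \<alpha>: "0 < \<alpha>"
    and X0: "X0 \<in> convex hull (kl_domain k \<alpha> z)"
  obtains X where "X \<in> convex hull (kl_domain k \<alpha> z)" "\<And>A. A \<in> \<A> \<Longrightarrow> A \<bullet> X = A \<bullet> X0"
    "C \<bullet> X \<le> C \<bullet> X0" "(rank X - k) * (rank X - k + 3) \<le> 2 * dim \<A>"
proof -
  let ?H = "convex hull (kl_domain k \<alpha> z) :: (real^'n^'n) set"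
  define K where "K = ?H \<inter> {X. mat 1 \<bullet> X = mat 1 \<bullet> X0} \<inter> (\<Inter>A\<in>\<A>. {X. A \<bullet> X = A \<bullet> X0})"
  have convK: "convex K"
    unfolding K_def by (intro convex_Int convex_INT convex_convex_hull convex_hyperplane)
  have "closed ((\<lambda>X. (z, X)) -` (hull_hypograph k \<alpha> :: (real \<times> (real^'n^'n)) set))"
    by (intro closed_vimage closed_hull_hypograph k \<alpha> continuous_intros)
  moreover have "(\<lambda>X. (z, X)) -` (hull_hypograph k \<alpha> :: (real \<times> (real^'n^'n)) set) = ?H"
    by (auto simp: hull_hypograph_def)
  ultimately have "closed ?H" by simp
  then have closedK: "closed K"
    unfolding K_def by (intro closed_Int closed_INT ballI closed_hyperplane)
  have "bounded K"
    unfolding bounded_iff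
  proof (intro exI ballI)
    fix X assume "X \<in> K"
    then show "norm X \<le> mat 1 \<bullet> X0"
      using norm_le_trace[OF hull_kl_domain_psd, of X k \<alpha> z] by (auto simp: K_def)
  qed
  then have compK: "compact K" using closedK by (simp add: compact_eq_bounded_closed)
  have X0K: "X0 \<in> K" using X0 by (auto simp: K_def)
  have "\<exists>x\<in>K. \<forall>y\<in>K. C \<bullet> x \<le> C \<bullet> y"
    using X0K by (intro continuous_attains_inf[OF compK] continuous_intros) auto
  then obtain X1 where X1: "X1 \<in> K" "\<And>X. X \<in> K \<Longrightarrow> C \<bullet> X1 \<le> C \<bullet> X"
    by blast
  define F where "F = K \<inter> {X. C \<bullet> X = C \<bullet> X1}"
  have "compact F" "convex F"
    unfolding F_def using compK convK by (auto intro: compact_Int_closed closed_hyperplane convex_Int convex_hyperplane)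
  then have "F = convex hull {x. x extreme_point_of F}" by (rule Krein_Milman_Minkowski)
  moreover have "X1 \<in> F" using X1 by (simp add: F_def)
  ultimately have "{x. x extreme_point_of F} \<noteq> {}" by (metis convex_hull_empty empty_iff)
  then obtain X where ext: "X extreme_point_of F" by blast
  then have XF: "X \<in> F" by (simp add: extreme_point_of_def)
  then have XH: "X \<in> ?H" and XA: "\<And>A. A \<in> \<A> \<Longrightarrow> A \<bullet> X = A \<bullet> X0" and XC: "C \<bullet> X \<le> C \<bullet> X0"
    using X1(2)[OF X0K] by (auto simp: F_def K_def)
  define s where "s = rank X - k"
  have "s * (s + 3) \<le> 2 * dim \<A>"
  proof (rule ccontr)
    assume neg: "\<not> s * (s + 3) \<le> 2 * dim \<A>"
    then have "s \<noteq> 0" by (intro notI) simp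
    then have rk: "rank X = k + s" "k < rank X" by (auto simp: s_def)
    obtain B \<theta> where B: "orthonormal_basis B" and \<theta>: "\<And>b. 0 \<le> \<theta> b" and XB: "X = spectral_sum B \<theta>"
      using psd_spectral_decomposition[OF hull_kl_domain_psd[OF XH]] by metis
    from cap_exists[of B \<theta> k, OF onb_finite[OF B] \<theta> k(1)]
    obtain t where t: "0 \<le> t" and cap: "(\<Sum>b\<in>B. min (\<theta> b) t) = real k * t"
      and t0: "t = 0 \<longrightarrow> card {b\<in>B. \<theta> b \<noteq> 0} \<le> k"
      by (elim exE conjE)
    have "t \<noteq> 0"
      using t0 rk rank_spectral_sum[OF B, of \<theta>] XB by auto
    with t have tpos: "0 < t" by simp
    define M where "M = {b\<in>B. 0 < \<theta> b \<and> \<theta> b < t}"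
    define q where "q = card M"
    have q: "s + 1 \<le> q"
      using block_rank[OF B \<theta> tpos cap] rk by (simp add: XB q_def M_def)
    have finM: "finite M" and onM: "\<forall>b\<in>M. \<forall>c\<in>M. b \<bullet> c = (if b = c then 1 else 0)"
      using onb_finite[OF B] onb_inner[OF B] by (auto simp: M_def)
    define W where "W = span {outer a b + outer b a | a b. a \<in> M \<and> b \<in> M}"
    have "q * (q + 1) \<le> 2 * dim W"
      unfolding W_def q_def by (rule dim_symmetric_outer_products[OF finM onM])
    moreover have "(s + 1) * (s + 2) \<le> q * (q + 1)"
      using q by (intro mult_mono) auto
    moreover have "(s + 1) * (s + 2) = s * (s + 3) + 2" by (simp add: algebra_simps)
    ultimately have "dim \<A> + 1 < dim W" using neg by linarith
    moreover have "dim (insert (mat 1) \<A>) \<le> dim \<A> + 1" by (simp add: dim_insert)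
    ultimately have "dim (insert (mat 1) \<A>) < dim W" by linarith
    then obtain \<Delta> where \<Delta>W: "\<Delta> \<in> W" and \<Delta>0: "\<Delta> \<noteq> 0"
      and \<Delta>orth: "\<And>A. A \<in> insert (mat 1) \<A> \<Longrightarrow> A \<bullet> \<Delta> = 0"
      using exists_orthogonal_in_subspace[of W "insert (mat 1) \<A>"] by (auto simp: W_def)
    have "W \<subseteq> {\<Delta>. transpose \<Delta> = \<Delta> \<and> (\<forall>v. \<Delta> *v v \<in> span M)}"
      unfolding W_def
    proof (rule span_minimal)
      show "subspace {\<Delta> :: real^'n^'n. transpose \<Delta> = \<Delta> \<and> (\<forall>v. \<Delta> *v v \<in> span M)}"
        by (auto simp: subspace_def transpose_add transpose_scaleR matrix_vector_mult_add_rdistrib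
            scaleR_matrix_vector_assoc[symmetric] span_add span_scale span_zero) (simp add: transpose_def vec_eq_iff)
    qed (auto simp: transpose_add transpose_outer add.commute matrix_vector_mult_add_rdistrib
          outer_mult_vec span_add span_scale span_base)
    then have \<Delta>: "transpose \<Delta> = \<Delta>" "\<And>v. \<Delta> *v v \<in> span M" "mat 1 \<bullet> \<Delta> = 0"
      using \<Delta>W \<Delta>orth by auto
    obtain \<delta> where \<delta>: "0 < \<delta>" and pert: "\<forall>\<epsilon>. \<bar>\<epsilon>\<bar> \<le> \<delta> \<longrightarrow>
        spectral_sum B \<theta> + \<epsilon> *\<^sub>R \<Delta> \<in> convex hull (kl_domain k \<alpha> (cap_value k \<alpha> B \<theta> t))"
      using block_perturbation[OF B \<theta> tpos \<alpha> k(2) cap M_def \<Delta>] by blast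
    have "z \<le> cap_value k \<alpha> B \<theta> t"
      using cap_value_supports_hull[OF B \<theta> t \<alpha> k(2) cap, of X z] XH by (simp add: XB)
    then have pertK: "X + \<epsilon> *\<^sub>R \<Delta> \<in> K" if "\<bar>\<epsilon>\<bar> \<le> \<delta>" for \<epsilon>
      using hull_kl_domain_antimono[OF _ pert[rule_format, OF that]] XF \<Delta>orth
      by (auto simp: F_def K_def XB inner_add_right)
    have CX: "C \<bullet> X = C \<bullet> X1" using XF by (simp add: F_def)
    \<comment> \<open>Both perturbed matrices compete in the minimization, so \<open>\<Delta>\<close> does not change the objective.\<close>
    have "0 \<le> \<delta> * (C \<bullet> \<Delta>)" "0 \<le> (- \<delta>) * (C \<bullet> \<Delta>)"
      using X1(2)[OF pertK[of \<delta>]] X1(2)[OF pertK[of "- \<delta>"]] \<delta> by (simp_all add: inner_diff_right inner_add_right CX)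
    then have "C \<bullet> \<Delta> = 0" using \<delta> by (simp add: zero_le_mult_iff mult_le_0_iff)
    then have mem: "X + \<delta> *\<^sub>R \<Delta> \<in> F" "X + (- \<delta>) *\<^sub>R \<Delta> \<in> F"
      using pertK[of \<delta>] pertK[of "- \<delta>"] \<delta> CX by (simp_all add: F_def inner_add_right inner_diff_right)
    have "X = midpoint (X + \<delta> *\<^sub>R \<Delta>) (X + (- \<delta>) *\<^sub>R \<Delta>)"
      by (simp add: midpoint_def scaleR_2[symmetric])
    moreover have "X + \<delta> *\<^sub>R \<Delta> \<noteq> X + (- \<delta>) *\<^sub>R \<Delta>"
    proof
      assume "X + \<delta> *\<^sub>R \<Delta> = X + (- \<delta>) *\<^sub>R \<Delta>"
      then have "\<delta> *\<^sub>R \<Delta> = (- \<delta>) *\<^sub>R \<Delta>" by (rule add_left_imp_eq)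
      then have "\<delta> = - \<delta>" using \<Delta>0 scaleR_right_imp_eq by blast
      then show False using \<delta> \<Delta>0 by simp
    qed
    ultimately have "X \<in> open_segment (X + \<delta> *\<^sub>R \<Delta>) (X + (- \<delta>) *\<^sub>R \<Delta>)"
      by (metis midpoint_in_open_segment)
    then show False using ext mem unfolding extreme_point_of_def by blast
  qed
  then show ?thesis using that[OF XH XA XC] by (simp add: s_def)
qed

text \<open>
For a matrix of rank at most \<open>k\<close> redistribution gains nothing: with cap \<open>0\<close> the level bound is its own
shifted log-determinant.
\<close>

lemma hull_kl_domain_low_rank:
  fixes X :: "real^'n^'n"
  assumes k: "k \<le> CARD('n)" and \<alpha>: "0 < \<alpha>"
    and X: "X \<in> convex hull (kl_domain k \<alpha> z)" and rank: "rank X \<le> k"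
  shows "X \<in> kl_domain k \<alpha> z"
proof (rule psd_spectral_decomposition[OF hull_kl_domain_psd[OF X]])
  fix B \<theta> assume B: "orthonormal_basis B" and \<theta>: "\<And>b. 0 \<le> \<theta> b" and XB: "X = spectral_sum B \<theta>"
  have cap: "(\<Sum>b\<in>B. min (\<theta> b) 0) = real k * 0" by (simp add: min_absorb2 \<theta>)
  have "z \<le> cap_value k \<alpha> B \<theta> 0"
    using cap_value_supports_hull[OF B \<theta> order_refl \<alpha> k cap, of X z] X by (simp add: XB)
  also have "\<dots> = logdet (X + \<alpha> *\<^sub>R mat 1)"
    by (simp add: XB cap_value_def max_absorb1 \<theta> logdet_shifted_spectral_sum[OF B _ \<alpha>])
  finally show ?thesis
    using rank hull_kl_domain_psd[OF X] by (simp add: kl_domain_def)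
qed

section \<open>Attainment of the relaxed optimum\<close>

text \<open>
The log-determinant grows logarithmically, so it is dominated by \<open>\<epsilon>\<close> times the trace up to a constant.
\<close>

lemma hull_kl_domain_sublinear:
  fixes \<epsilon> \<alpha> :: real
  assumes \<epsilon>: "0 < \<epsilon>" and \<alpha>: "0 < \<alpha>"
  shows "\<exists>c. \<forall>z. \<forall>X \<in> convex hull (kl_domain k \<alpha> z :: (real^'n^'n) set). z \<le> c + \<epsilon> * (mat 1 \<bullet> X)"
proof (intro exI allI ballI)
  let ?c = "real CARD('n) * (\<epsilon> * \<alpha> - ln \<epsilon> - 1)"
  fix z and X :: "real^'n^'n" assume X: "X \<in> convex hull (kl_domain k \<alpha> z)"
  have "z \<le> ?c + \<epsilon> * (mat 1 \<bullet> Z)" if Z: "Z \<in> kl_domain k \<alpha> z" for Z :: "real^'n^'n"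
  proof -
    have "psd Z" and zZ: "z \<le> logdet (Z + \<alpha> *\<^sub>R mat 1)" using Z by (auto simp: kl_domain_def)
    then obtain C \<mu> where C: "orthonormal_basis C" and \<mu>: "\<And>c. 0 \<le> \<mu> c" and ZC: "Z = spectral_sum C \<mu>"
      using psd_spectral_decomposition by metis
    have "logdet (Z + \<alpha> *\<^sub>R mat 1) = (\<Sum>c\<in>C. ln (\<mu> c + \<alpha>))"
      by (simp add: ZC logdet_shifted_spectral_sum[OF C _ \<alpha>] \<mu>)
    also have "\<dots> \<le> (\<Sum>c\<in>C. \<epsilon> * \<mu> c + (\<epsilon> * \<alpha> - ln \<epsilon> - 1))"
    proof (rule sum_mono)
      fix c
      have "0 < \<mu> c + \<alpha>" using \<mu> \<alpha> by (simp add: add_nonneg_pos)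
      then have "ln \<epsilon> + ln (\<mu> c + \<alpha>) = ln (\<epsilon> * (\<mu> c + \<alpha>))" using \<epsilon> by (simp only: ln_mult_pos)
      also have "\<dots> \<le> \<epsilon> * (\<mu> c + \<alpha>) - 1"
        using \<epsilon> \<open>0 < \<mu> c + \<alpha>\<close> by (intro ln_le_minus_one mult_pos_pos)
      finally show "ln (\<mu> c + \<alpha>) \<le> \<epsilon> * \<mu> c + (\<epsilon> * \<alpha> - ln \<epsilon> - 1)"
        by (simp add: distrib_left)
    qed
    also have "\<dots> = ?c + \<epsilon> * (mat 1 \<bullet> Z)"
      unfolding ZC trace_spectral_sum[OF C]
      by (simp only: sum.distrib sum_distrib_left[symmetric] sum_constant onb_card[OF C] add.commute)
    finally show ?thesis using zZ by simp
  qed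
  then have "kl_domain k \<alpha> z \<subseteq> {Z :: real^'n^'n. (\<epsilon> *\<^sub>R mat 1) \<bullet> Z \<ge> z - ?c}"
    by (force simp: algebra_simps)
  then have "convex hull (kl_domain k \<alpha> z) \<subseteq> {Z :: real^'n^'n. (\<epsilon> *\<^sub>R mat 1) \<bullet> Z \<ge> z - ?c}"
    by (intro hull_minimal convex_halfspace_ge)
  then have "(\<epsilon> *\<^sub>R mat 1) \<bullet> X \<ge> z - ?c" using X by blast
  then show "z \<le> ?c + \<epsilon> * (mat 1 \<bullet> X)" by simp
qed

text \<open>
With \<open>\<tau>\<close> the trace of \<open>X\<close>, the spectral decomposition of \<open>X\<close> is a convex combination of the rank one
matrices \<open>\<tau> b b\<^sup>T\<close>, which all have the same log-determinant. This crude lower bound on the level tends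
to infinity with the trace.
\<close>

lemma psd_in_rank_one_hull:
  fixes X :: "real^'n^'n"
  assumes X: "psd X" and pos: "0 < mat 1 \<bullet> X" and k: "1 \<le> k" and \<alpha>: "0 < \<alpha>"
  shows "X \<in> convex hull (kl_domain k \<alpha> ((real CARD('n) - 1) * ln \<alpha> + ln (mat 1 \<bullet> X + \<alpha>)))"
proof (rule psd_spectral_decomposition[OF X])
  let ?\<tau> = "mat 1 \<bullet> X"
  fix B \<theta> assume B: "orthonormal_basis B" and \<theta>: "\<And>b. 0 \<le> \<theta> b" and XB: "X = spectral_sum B \<theta>"
  have fin: "finite B" using B by (rule onb_finite)
  have \<tau>: "?\<tau> = (\<Sum>b\<in>B. \<theta> b)" by (simp add: XB trace_spectral_sum[OF B])
  have "?\<tau> *\<^sub>R outer b b \<in> kl_domain k \<alpha> ((real CARD('n) - 1) * ln \<alpha> + ln (?\<tau> + \<alpha>))" if b: "b \<in> B" for b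
  proof -
    define \<eta> where "\<eta> c = (if c = b then ?\<tau> else 0)" for c
    have \<eta>: "0 \<le> \<eta> c" for c using pos by (simp add: \<eta>_def)
    have "spectral_sum B \<eta> = (\<Sum>c\<in>B. if c = b then ?\<tau> *\<^sub>R outer b b else 0)"
      unfolding spectral_sum_def by (rule sum.cong) (auto simp: \<eta>_def)
    then have eq: "?\<tau> *\<^sub>R outer b b = spectral_sum B \<eta>" using fin b by simp
    have "{c\<in>B. \<eta> c \<noteq> 0} = {b}" using b pos by (auto simp: \<eta>_def)
    then have rk: "rank (spectral_sum B \<eta>) = 1" by (simp add: rank_spectral_sum[OF B])
    have "(\<Sum>c\<in>B. ln (\<eta> c + \<alpha>)) = ln (?\<tau> + \<alpha>) + (\<Sum>c\<in>B - {b}. ln \<alpha>)"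
      using fin b by (simp add: sum.remove[of B b] \<eta>_def)
    also have "(\<Sum>c\<in>B - {b}. ln \<alpha>) = (real CARD('n) - 1) * ln \<alpha>"
      using fin b onb_card[OF B] by (simp add: card_Diff_singleton of_nat_diff)
    finally show ?thesis
      unfolding eq using psd_spectral_sum[of B \<eta>] \<eta> rk k
      by (simp add: kl_domain_def logdet_shifted_spectral_sum[OF B _ \<alpha>])
  qed
  then have "(\<Sum>b\<in>B. (\<theta> b / ?\<tau>) *\<^sub>R (?\<tau> *\<^sub>R outer b b)) \<in>
      convex hull (kl_domain k \<alpha> ((real CARD('n) - 1) * ln \<alpha> + ln (?\<tau> + \<alpha>)))"
    using fin \<theta> pos
    by (intro convex_sum convex_convex_hull hull_inc) (auto simp: \<tau> sum_divide_distrib[symmetric])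
  also have "(\<Sum>b\<in>B. (\<theta> b / ?\<tau>) *\<^sub>R (?\<tau> *\<^sub>R outer b b)) = X"
    using pos by (simp add: XB spectral_sum_def)
  finally show ?thesis .
qed

text \<open>
The direction is a limit of normalized differences between \<open>p\<close> and points of \<open>S\<close> that are farther and
farther away.
\<close>

lemma unbounded_closed_convex_contains_ray:
  fixes S :: "'a::euclidean_space set"
  assumes S: "closed S" "convex S" "\<not> bounded S" and p: "p \<in> S"
  obtains d where "norm d = 1" "\<And>s. 0 \<le> s \<Longrightarrow> p + s *\<^sub>R d \<in> S"
proof -
  have "\<exists>x\<in>S. real n < norm (x - p)" for n
  proof (rule ccontr)
    assume "\<not> ?thesis"
    then have "S \<subseteq> cball p (real n)" by (auto simp: dist_norm norm_minus_commute not_less)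
    then show False using S(3) bounded_cball bounded_subset by blast
  qed
  then obtain x where x: "\<And>n. x n \<in> S" "\<And>n. real n < norm (x n - p)" by metis
  have pos: "0 < norm (x n - p)" for n using x(2)[of n] of_nat_0_le_iff[of n] by linarith
  define u where "u n = (1 / norm (x n - p)) *\<^sub>R (x n - p)" for n
  have "\<forall>n. u n \<in> sphere 0 1"
  proof
    fix n show "u n \<in> sphere 0 1" using pos[of n] by (simp add: u_def)
  qed
  then obtain d r where d: "d \<in> sphere 0 1" and r: "strict_mono (r :: nat \<Rightarrow> nat)"
    and lim: "(u \<circ> r) \<longlonglongrightarrow> d"
    using compact_sphere[of "0::'a" 1] unfolding compact_def by metis
  have "p + s *\<^sub>R d \<in> S" if s: "0 \<le> s" for s
  proof (rule Lim_in_closed_set[OF S(1)])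
    show "((\<lambda>n. p + s *\<^sub>R (u \<circ> r) n) \<longlongrightarrow> p + s *\<^sub>R d) sequentially"
      by (intro tendsto_intros lim)
    obtain N :: nat where N: "s \<le> real N" using real_arch_simple by blast
    show "\<forall>\<^sub>F n in sequentially. p + s *\<^sub>R (u \<circ> r) n \<in> S"
      using eventually_ge_at_top[of N]
    proof eventually_elim
      case (elim n)
      let ?y = "x (r n)"
      have "real n \<le> real (r n)" using seq_suble[OF r] by simp
      then have "s \<le> norm (?y - p)" using N elim x(2)[of "r n"] by linarith
      then have c: "0 \<le> s / norm (?y - p)" "s / norm (?y - p) \<le> 1"
        using s pos[of "r n"] by auto
      have "(1 - s / norm (?y - p)) *\<^sub>R p + (s / norm (?y - p)) *\<^sub>R ?y \<in> S"
        by (rule convexD[OF S(2) p x(1)]) (use c in auto)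
      also have "(1 - s / norm (?y - p)) *\<^sub>R p + (s / norm (?y - p)) *\<^sub>R ?y = p + s *\<^sub>R (u \<circ> r) n"
        by (simp add: u_def algebra_simps)
      finally show ?case .
    qed
  qed simp
  then show ?thesis using d that by simp
qed

lemma slope_nonneg:
  fixes a b :: real
  assumes "\<And>s. 0 \<le> s \<Longrightarrow> 0 \<le> a + s * b"
  shows "0 \<le> b"
proof (rule ccontr)
  assume "\<not> 0 \<le> b"
  then have b: "b < 0" by simp
  then have "0 \<le> (\<bar>a\<bar> + 1) / (- b)" by (intro divide_nonneg_pos) auto
  then have "0 \<le> a + (\<bar>a\<bar> + 1) / (- b) * b" by (rule assms)
  also have "\<dots> = a - (\<bar>a\<bar> + 1)" using b by simp
  finally show False by linarith
qed

text \<open>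
Suppose that a sublevel set is unbounded and let \<open>(\<zeta>, D)\<close> be the direction of a ray in it. Then \<open>D\<close> is
positive semidefinite, \<open>\<langle>C, D\<rangle> \<le> \<zeta>\<close>, and \<open>\<zeta> \<le> 0\<close> since the level grows sublinearly. As \<open>C\<close> is
positive semidefinite, \<open>\<zeta>\<close> and \<open>\<langle>C, D\<rangle>\<close> vanish, so \<open>D\<close> is nonzero and has positive trace. Along the
ray the linear part stays constant while the attainable level tends to infinity, contradicting the
lower bound \<open>m\<close>. So the sublevel set is compact.
\<close>

lemma relaxation_attained:
  fixes C :: "real^'n^'n" and L :: "(real^'n^'n) set" and \<alpha> m :: real
  assumes k: "1 \<le> k" "k \<le> CARD('n)" and \<alpha>: "0 < \<alpha>"
    and C: "psd C" and L: "closed L" "convex L"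
    and p0: "X0 \<in> L" "X0 \<in> convex hull (kl_domain k \<alpha> z0)"
    and bound: "\<And>z X. X \<in> L \<Longrightarrow> X \<in> convex hull (kl_domain k \<alpha> z) \<Longrightarrow> m \<le> C \<bullet> X - z"
  obtains z1 X1 where "X1 \<in> L" "X1 \<in> convex hull (kl_domain k \<alpha> z1)"
    "\<And>z X. X \<in> L \<Longrightarrow> X \<in> convex hull (kl_domain k \<alpha> z) \<Longrightarrow> C \<bullet> X1 - z1 \<le> C \<bullet> X - z"
proof -
  define w where "w = (- 1 :: real, C)"
  have w: "w \<bullet> (z, X) = C \<bullet> X - z" for z X by (simp add: w_def)
  define S where "S = hull_hypograph k \<alpha> \<inter> (UNIV \<times> L) \<inter> {p. w \<bullet> p \<le> w \<bullet> (z0, X0)}"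
  have S_iff: "(z, X) \<in> S \<longleftrightarrow> X \<in> convex hull (kl_domain k \<alpha> z) \<and> X \<in> L \<and> C \<bullet> X - z \<le> C \<bullet> X0 - z0"
    for z X by (simp add: S_def hull_hypograph_def w)
  have clS: "closed S" unfolding S_def
    by (intro closed_Int closed_hull_hypograph closed_Times closed_halfspace_le L k \<alpha> closed_UNIV)
  have coS: "convex S" unfolding S_def
    by (intro convex_Int convex_hull_hypograph convex_Times convex_halfspace_le L k \<alpha> convex_UNIV)
  have p0S: "(z0, X0) \<in> S" using p0 by (simp add: S_iff)
  have "bounded S"
  proof (rule ccontr)
    assume "\<not> bounded S"
    then obtain d where d: "norm d = 1" and ray: "\<And>s. 0 \<le> s \<Longrightarrow> (z0, X0) + s *\<^sub>R d \<in> S"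
      using unbounded_closed_convex_contains_ray[OF clS coS _ p0S] by metis
    obtain \<zeta> D where dD: "d = (\<zeta>, D)" by (cases d)
    have ray': "X0 + s *\<^sub>R D \<in> convex hull (kl_domain k \<alpha> (z0 + s * \<zeta>))" "X0 + s *\<^sub>R D \<in> L"
      "C \<bullet> (X0 + s *\<^sub>R D) - (z0 + s * \<zeta>) \<le> C \<bullet> X0 - z0" if "0 \<le> s" for s
      using ray[OF that] by (simp_all add: dD S_iff)
    have psds: "psd (X0 + s *\<^sub>R D)" if "0 \<le> s" for s
      using ray'(1)[OF that] by (rule hull_kl_domain_psd)
    have "psd D"
      unfolding psd_def
    proof
      have "transpose (X0 + 1 *\<^sub>R D) = X0 + 1 *\<^sub>R D" "transpose (X0 + 0 *\<^sub>R D) = X0 + 0 *\<^sub>R D"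
        using psds[of 1] psds[of 0] unfolding psd_def by auto
      then show "transpose D = D" by (simp add: transpose_add)
      show "\<forall>v. 0 \<le> v \<bullet> (D *v v)"
      proof
        fix v
        have "0 \<le> v \<bullet> (X0 *v v) + s * (v \<bullet> (D *v v))" if "0 \<le> s" for s
          using psds[OF that] unfolding psd_def
          by (simp add: matrix_vector_mult_add_rdistrib scaleR_matrix_vector_assoc[symmetric] inner_add_right)
        then show "0 \<le> v \<bullet> (D *v v)" by (rule slope_nonneg)
      qed
    qed
    define T where "T = mat 1 \<bullet> D"
    have T0: "0 \<le> T" unfolding T_def using norm_le_trace[OF \<open>psd D\<close>] norm_ge_zero[of D] by linarith
    have CD: "0 \<le> C \<bullet> D" by (rule psd_inner_nonneg[OF C \<open>psd D\<close>])
    have CD\<zeta>: "C \<bullet> D \<le> \<zeta>" using ray'(3)[of 1] by (simp add: inner_add_right)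
    have \<zeta>\<epsilon>: "\<zeta> \<le> \<epsilon> * T" if \<epsilon>: "0 < \<epsilon>" for \<epsilon>
    proof -
      obtain c where c: "\<And>z X. X \<in> convex hull (kl_domain k \<alpha> z :: (real^'n^'n) set) \<Longrightarrow> z \<le> c + \<epsilon> * (mat 1 \<bullet> X)"
        using hull_kl_domain_sublinear[OF \<epsilon> \<alpha>, of k] by blast
      have "0 \<le> (c + \<epsilon> * (mat 1 \<bullet> X0) - z0) + s * (\<epsilon> * T - \<zeta>)" if "0 \<le> s" for s
        using c[OF ray'(1)[OF that]] by (simp add: inner_add_right T_def algebra_simps)
      then have "0 \<le> \<epsilon> * T - \<zeta>" by (rule slope_nonneg)
      then show ?thesis by simp
    qed
    have "\<zeta> \<le> 0"
    proof (rule ccontr)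
      assume "\<not> \<zeta> \<le> 0"
      then have z: "0 < \<zeta>" by simp
      have "\<zeta> \<le> \<zeta> / (T + 1) * T" by (rule \<zeta>\<epsilon>) (use z T0 in auto)
      then have "\<zeta> * (T + 1) \<le> \<zeta> * T" using T0 by (simp add: field_simps)
      then show False using z by (simp add: distrib_left)
    qed
    then have \<zeta>0: "\<zeta> = 0" and CD0: "C \<bullet> D = 0" using CD CD\<zeta> by auto
    have "D \<noteq> 0" using d by (auto simp: dD \<zeta>0)
    then have T: "0 < T" unfolding T_def using norm_le_trace[OF \<open>psd D\<close>] by (metis less_le_trans zero_less_norm_iff)
    define \<tau> where "\<tau> = mat 1 \<bullet> X0"
    have "psd X0" using psds[of 0] by simp
    then have \<tau>: "0 \<le> \<tau>" unfolding \<tau>_def using norm_le_trace[of X0] norm_ge_zero[of X0] by linarith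
    \<comment> \<open>The ray is followed until the level from the rank one decomposition would push the objective
      below \<open>m\<close>.\<close>
    define c where "c = C \<bullet> X0 - m - (real CARD('n) - 1) * ln \<alpha>"
    define s where "s = exp c / T"
    have s: "0 < s" "s * T = exp c" using T by (auto simp: s_def)
    have tr: "mat 1 \<bullet> (X0 + s *\<^sub>R D) = \<tau> + exp c" using s by (simp add: \<tau>_def inner_add_right T_def)
    have trpos: "0 < mat 1 \<bullet> (X0 + s *\<^sub>R D)" unfolding tr using \<tau> by (simp add: add_nonneg_pos)
    have "m \<le> C \<bullet> (X0 + s *\<^sub>R D) - ((real CARD('n) - 1) * ln \<alpha> + ln (\<tau> + exp c + \<alpha>))"
      using bound[OF ray'(2) psd_in_rank_one_hull[OF psds trpos k(1) \<alpha>], of] s(1) unfolding tr by simp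
    then have "ln (\<tau> + exp c + \<alpha>) \<le> c" by (simp add: c_def inner_add_right CD0)
    moreover have "c < ln (\<tau> + exp c + \<alpha>)"
    proof -
      have "exp c < \<tau> + exp c + \<alpha>" using \<tau> \<alpha> by simp
      moreover from this have "0 < \<tau> + exp c + \<alpha>" by (rule less_trans[OF exp_gt_zero])
      ultimately have "ln (exp c) < ln (\<tau> + exp c + \<alpha>)" by (simp only: ln_less_cancel_iff exp_gt_zero)
      then show ?thesis by simp
    qed
    ultimately show False by simp
  qed
  with clS have "compact S" by (simp add: compact_eq_bounded_closed)
  then have "\<exists>p\<in>S. \<forall>q\<in>S. w \<bullet> p \<le> w \<bullet> q"
    using p0S by (intro continuous_attains_inf continuous_intros) auto
  then obtain z1 X1 where p1: "(z1, X1) \<in> S" and "\<forall>q\<in>S. w \<bullet> (z1, X1) \<le> w \<bullet> q"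
    by (metis surj_pair)
  then have min: "C \<bullet> X1 - z1 \<le> C \<bullet> X - z" if "(z, X) \<in> S" for z X
    using that by (metis w)
  show ?thesis
  proof (rule that)
    show "X1 \<in> L" "X1 \<in> convex hull (kl_domain k \<alpha> z1)" using p1 by (auto simp: S_iff)
    fix z X assume "X \<in> L" "X \<in> convex hull (kl_domain k \<alpha> z)"
    then show "C \<bullet> X1 - z1 \<le> C \<bullet> X - z"
      using min[of z X] p1 by (cases "C \<bullet> X - z \<le> C \<bullet> X0 - z0") (auto simp: S_iff)
  qed
qed

section \<open>The kernel learning problem\<close>

text \<open>
The transpose of the pseudoinverse \<open>P\<close> of a symmetric matrix satisfies the Penrose equations too, so
\<open>P\<close> is symmetric by uniqueness. Then \<open>P = P Y P\<close> gives \<open>\<langle>v, P v\<rangle> = \<langle>P v, Y P v\<rangle>\<close>.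
\<close>

lemma psd_pinv:
  fixes Y :: "real^'n^'n"
  assumes "psd Y"
  shows "psd (pinv Y)"
proof -
  let ?P = "pinv Y"
  have Y: "transpose Y = Y" using assms by (simp add: psd_def)
  have P: "Y ** ?P ** Y = Y" "?P ** Y ** ?P = ?P" "transpose (Y ** ?P) = Y ** ?P" "transpose (?P ** Y) = ?P ** Y"
    using is_pinv_pinv[of Y] by (auto simp: is_pinv_def)
  have "Y ** transpose ?P ** Y = transpose (Y ** ?P ** Y)"
    "transpose ?P ** Y ** transpose ?P = transpose (?P ** Y ** ?P)"
    "Y ** transpose ?P = transpose (?P ** Y)" "transpose ?P ** Y = transpose (Y ** ?P)"
    by (simp_all add: matrix_transpose_mul Y matrix_mul_assoc)
  then have "is_pinv Y (transpose ?P)"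
    unfolding is_pinv_def by (simp add: P Y)
  then have sym: "transpose ?P = ?P"
    using is_pinv_pinv is_pinv_unique by blast
  have "0 \<le> v \<bullet> (?P *v v)" for v
  proof -
    have "v \<bullet> (?P *v v) = v \<bullet> (?P *v (Y *v (?P *v v)))"
      using P(2) by (metis matrix_vector_mul_assoc)
    also have "\<dots> = (Y *v (?P *v v)) \<bullet> (?P *v v)" by (rule symmetric_inner[OF sym])
    also have "\<dots> \<ge> 0" using assms by (simp add: psd_def inner_commute)
    finally show ?thesis .
  qed
  with sym show ?thesis by (simp add: psd_def)
qed

lemma closed_linear_constraints: "closed (linear_constraints m A bl bu)"
proof -
  have "linear_constraints m A bl bu =
      (\<Inter>i\<in>{1..m}. {X. bl i \<le> ereal (A i \<bullet> X)} \<inter> {X. ereal (A i \<bullet> X) \<le> bu i})"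
    by (auto simp: linear_constraints_def)
  moreover have "closed \<dots>"
    by (intro closed_INT ballI closed_Int closed_Collect_le continuous_on_const
        continuous_on_ereal continuous_intros)
  ultimately show ?thesis by simp
qed

lemma convex_linear_constraints: "convex (linear_constraints m A bl bu)"
proof (rule convexI)
  fix X Z and u v :: real
  assume X: "X \<in> linear_constraints m A bl bu" and Z: "Z \<in> linear_constraints m A bl bu"
    and uv: "0 \<le> u" "0 \<le> v" "u + v = 1"
  have "bl i \<le> ereal (A i \<bullet> (u *\<^sub>R X + v *\<^sub>R Z)) \<and> ereal (A i \<bullet> (u *\<^sub>R X + v *\<^sub>R Z)) \<le> bu i"
    if i: "i \<in> {1..m}" for i
  proof -
    let ?a = "A i \<bullet> X" and ?b = "A i \<bullet> Z"
    have "u * min ?a ?b + v * min ?a ?b \<le> u * ?a + v * ?b" "u * ?a + v * ?b \<le> u * max ?a ?b + v * max ?a ?b"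
      using uv by (auto intro!: add_mono mult_left_mono)
    then have "min ?a ?b \<le> u * ?a + v * ?b" "u * ?a + v * ?b \<le> max ?a ?b"
      using uv by (simp_all add: distrib_right[symmetric])
    moreover have "bl i \<le> ereal (min ?a ?b)" "ereal (max ?a ?b) \<le> bu i"
      using X Z i by (auto simp: linear_constraints_def min_def max_def)
    ultimately show ?thesis
      by (metis (no_types, lifting) ereal_less_eq(3) inner_add_right inner_scaleR_right order_trans)
  qed
  then show "u *\<^sub>R X + v *\<^sub>R Z \<in> linear_constraints m A bl bu"
    by (simp add: linear_constraints_def)
qed

theorem corollary1:
  fixes Y :: "real^'n^'n" and A :: "nat \<Rightarrow> real^'n^'n"
    and bl bu :: "nat \<Rightarrow> ereal" and \<alpha> :: real and k m mt :: nat
  assumes "1 \<le> k" and "k \<le> CARD('n)"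
    and "psd Y" and "rank Y \<le> k"
    and "0 < \<alpha>"
    and "\<And>i. i \<in> {1..m} \<Longrightarrow> transpose (A i) = A i"
    and "\<And>i. i \<in> {1..m} \<Longrightarrow> bl i \<le> bu i"
    and "mt = dim (span (A ` {1..m}))"
  shows
    "(\<bar>optimal_value (kl_objective \<alpha> Y) (klr_feasible k \<alpha> m A bl bu)\<bar> \<noteq> \<infinity> \<longrightarrow>
       (\<exists>z X. optimal_solution (kl_objective \<alpha> Y) (klr_feasible k \<alpha> m A bl bu) (z, X) \<and>
          int (rank X) \<le> int k + \<lfloor>sqrt (2 * real mt + 9 / 4) - 3 / 2\<rfloor>)) \<and>
     (mt \<le> 1 \<longrightarrow>
       optimal_value (kl_objective \<alpha> Y) (klr_feasible k \<alpha> m A bl bu) =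
       optimal_value (kl_objective \<alpha> Y) (kl_feasible k \<alpha> m A bl bu))"
proof -
  let ?f = "kl_objective \<alpha> Y" and ?R = "klr_feasible k \<alpha> m A bl bu" and ?K = "kl_feasible k \<alpha> m A bl bu"
  let ?L = "linear_constraints m A bl bu"
  define e where "e = logdet (Y + \<alpha> *\<^sub>R mat 1)"
  have f: "?f (z, X) = pinv Y \<bullet> X - z + e" for z X by (simp add: kl_objective_def e_def)
  have R: "(z, X) \<in> ?R \<longleftrightarrow> X \<in> convex hull (kl_domain k \<alpha> z) \<and> X \<in> ?L" for z X
    by (simp add: klr_feasible_def)
  have reduce: "\<exists>X. (z, X) \<in> ?R \<and> ?f (z, X) \<le> ?f (z, X0) \<and> (rank X - k) * (rank X - k + 3) \<le> 2 * mt"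
    if X0: "(z, X0) \<in> ?R" for z X0
  proof -
    have "X0 \<in> convex hull (kl_domain k \<alpha> z)" using X0 by (simp add: R)
    then obtain X where X: "X \<in> convex hull (kl_domain k \<alpha> z)" "\<And>B. B \<in> A ` {1..m} \<Longrightarrow> B \<bullet> X = B \<bullet> X0"
      "pinv Y \<bullet> X \<le> pinv Y \<bullet> X0" "(rank X - k) * (rank X - k + 3) \<le> 2 * dim (A ` {1..m})"
      using rank_reduction[OF assms(1,2,5), of X0 z "A ` {1..m}" "pinv Y"] by metis
    then have "X \<in> ?L" using X0 by (simp add: R linear_constraints_def)
    then show ?thesis using X assms(8) by (auto simp: R f)
  qed
  show ?thesis
  proof (intro conjI impI)
    assume fin: "\<bar>optimal_value ?f ?R\<bar> \<noteq> \<infinity>"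
    then obtain r where r: "optimal_value ?f ?R = ereal r" by auto
    have lower: "r \<le> ?f p" if "p \<in> ?R" for p
      using INF_lower[OF that, of "\<lambda>x. ereal (?f x)"] r by (simp add: optimal_value_def)
    have "?R \<noteq> {}" using r by (auto simp: optimal_value_def top_ereal_def)
    then obtain z0 X0 where "(z0, X0) \<in> ?R" by auto
    then have p0: "X0 \<in> ?L" "X0 \<in> convex hull (kl_domain k \<alpha> z0)" by (auto simp: R)
    have "r - e \<le> pinv Y \<bullet> X - z" if "X \<in> ?L" "X \<in> convex hull (kl_domain k \<alpha> z)" for z X
      using lower[of "(z, X)"] that by (simp add: R f)
    then obtain z1 X1 where p1: "X1 \<in> ?L" "X1 \<in> convex hull (kl_domain k \<alpha> z1)"
      and min: "\<And>z X. X \<in> ?L \<Longrightarrow> X \<in> convex hull (kl_domain k \<alpha> z) \<Longrightarrow> pinv Y \<bullet> X1 - z1 \<le> pinv Y \<bullet> X - z"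
      using relaxation_attained[OF assms(1,2,5) psd_pinv[OF assms(3)] closed_linear_constraints
          convex_linear_constraints p0] by metis
    obtain X where X: "(z1, X) \<in> ?R" "?f (z1, X) \<le> ?f (z1, X1)"
      "(rank X - k) * (rank X - k + 3) \<le> 2 * mt"
      using reduce[of z1 X1] p1 by (auto simp: R)
    have "?f (z1, X) \<le> ?f q" if "q \<in> ?R" for q
    proof (cases q)
      case (Pair z Z)
      then show ?thesis using X(2) min[of Z z] that by (simp add: R f)
    qed
    then have opt: "optimal_solution ?f ?R (z1, X)"
      using X(1) by (auto simp: is_arg_min_def not_less)
    define s where "s = rank X - k"
    have "real (s * (s + 3)) \<le> real (2 * mt)"
      using X(3) unfolding s_def of_nat_le_iff .
    then have "(real s + 3 / 2)\<^sup>2 \<le> 2 * real mt + 9 / 4"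
      by (simp add: power2_eq_square algebra_simps)
    then have "real s + 3 / 2 \<le> sqrt (2 * real mt + 9 / 4)" by (rule real_le_rsqrt)
    then have "int s \<le> \<lfloor>sqrt (2 * real mt + 9 / 4) - 3 / 2\<rfloor>" by (simp add: le_floor_iff)
    then have "int (rank X) \<le> int k + \<lfloor>sqrt (2 * real mt + 9 / 4) - 3 / 2\<rfloor>" by (simp add: s_def)
    with opt show "\<exists>z X. optimal_solution ?f ?R (z, X) \<and>
          int (rank X) \<le> int k + \<lfloor>sqrt (2 * real mt + 9 / 4) - 3 / 2\<rfloor>" by blast
  next
    assume mt: "mt \<le> 1"
    have sub: "?K \<subseteq> ?R" by (auto simp: kl_feasible_def klr_feasible_def intro: hull_inc)
    show "optimal_value ?f ?R = optimal_value ?f ?K"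
    proof (rule antisym)
      show "optimal_value ?f ?R \<le> optimal_value ?f ?K"
        unfolding optimal_value_def using sub by (rule INF_superset_mono) simp
      show "optimal_value ?f ?K \<le> optimal_value ?f ?R"
        unfolding optimal_value_def
      proof (rule INF_mono)
        fix p assume p: "p \<in> ?R"
        obtain z X0 where zX: "p = (z, X0)" by (cases p)
        obtain X where X: "(z, X) \<in> ?R" "?f (z, X) \<le> ?f p"
          "(rank X - k) * (rank X - k + 3) \<le> 2 * mt"
          using reduce[of z X0] p zX by auto
        have "rank X \<le> k"
        proof (rule ccontr)
          assume "\<not> rank X \<le> k"
          then have "1 * (1 + 3) \<le> (rank X - k) * (rank X - k + 3)" by (intro mult_mono) auto
          then show False using X(3) mt by simp
        qed
        then have "(z, X) \<in> ?K"
          using X(1) hull_kl_domain_low_rank[OF assms(2,5)] by (simp add: R kl_feasible_def)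
        then show "\<exists>q\<in>?K. ereal (?f q) \<le> ereal (?f p)" using X(2) by (intro bexI[of _ "(z, X)"]) auto
      qed
    qed
  qed
qed

end
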